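(* Let $p\ge1$. Suppose that $f:\mathbb R\to\mathbb R$ is Lipschitz continuous with $\|f\|_{\mathrm{Lip}}:=\sup_{u\ne v}\frac{|f(u)-f(v)|}{|u-v|}<\gamma$, where $\gamma>0$ is the constant in the Poincaré inequality $\|\nabla v\|^2\ge\gamma\|v\|^2$ for all $v\in\mathbb H^1_0$, and that there is a constant $\beta\in[0,2]$ such that $\|A^{\frac{\beta-2}{2}}\|_{\mathcal L_2^0}<\infty$. Let $u$ be the (mild) solution of $$-\Delta u=f(u)+\dot W^Q\ \text{ in }\mathscr O,\qquad u=0\ \text{ on }\partial\mathscr O,$$ and let $u_N^h\in V_h$ be the finite element solution of $$(\nabla u_N^h,\nabla v)=(f(u_N^h),v)+(\mathbb P_N\dot W^Q,v),\qquad\forall\,v\in V_h.$$ Then there exists a constant $C$, independent of $N$ and $h$, such that $$\big(\mathbb E\big[\|u-u_N^h\|^p\big]\big)^{\frac1p}\le C\Big(N^{-\frac{\beta}{d}}+h^2N^{\frac{2-\beta}{d}}\Big)\Big(1+\|A^{\frac{\beta-2}{2}}\|_{\mathcal L_2^0}\Big).$$ In particular, if $f$ has bounded derivatives up to order $r-1$ for some $r\ge2$ (with $r$ the polynomial degree of $V_h$), then $$\big(\mathbb E\big[\|u-u_N^h\|^p\big]\big)^{\frac1p}\le C\Big(N^{-\frac{\beta}{d}}+h^{r+1}N^{\frac{r+1-\beta}{d}}\Big)\Big(1+\|A^{\frac{\beta-2}{2}}\|_{\mathcal L_2^0}\Big).$$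
   Context: $(\Omega,\mathscr F,\mathbb P)$ is a probability space and $\mathscr O\subset\mathbb R^d$ is a bounded open domain with regular (piecewise smooth) boundary $\partial\mathscr O$. $\mathbb H=L^2(\mathscr O)$ with inner product $(\cdot,\cdot)$ and norm $\|\cdot\|$. $\mathbb H^r$ ($r\in\mathbb N$) is the usual Sobolev space on $\mathscr O$ of functions with square integrable derivatives up to order $r$, with norm $\|\cdot\|_{\mathbb H^r}$. $\mathbb H^1_0$ is the subspace of $\mathbb H^1$ of functions vanishing on $\partial\mathscr O$. $A=-\Delta$ is the negative Dirichlet Laplacian, with eigenvalues $0<\lambda_1\le\lambda_2\le\cdots$ (of finite multiplicity, in ascending order) and eigenvectors $\varphi_k$, $A\varphi_k=\lambda_k\varphi_k$, forming a complete orthonormal basis of $L^2(\mathscr O)$. Weyl's law is taken as known: there is $C>0$ with $C^{-1}k^{2/d}\le\lambda_k\le Ck^{2/d}$. For $s\in\mathbb R$, $\dot{\mathbb H}^s=\{v:\ \|v\|_s:=(\sum_{k\ge1}\lambda_k^s(v,\varphi_k)^2)^{1/2}<\infty\}$ (for $s<0$, understood as formal series in the $\varphi_k$, i.e. the dual of $\dot{\mathbb H}^{-s}$). For $s\in\mathbb N$ the space $\dot{\mathbb H}^s$ is taken as known to coincide with $\mathbb H^s$ with additional boundary conditions. Powers of $A$ act by $A^{s}\varphi_k=\lambda_k^{s}\varphi_k$; in particular $A^{-1}:\dot{\mathbb H}^{s}\to\dot{\mathbb H}^{s+2}$. Noise: $Q$ is the (nonnegative, self-adjoint) covariance operator with eigensystem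 $Q\psi_m=\sigma_m\psi_m$, $m\ge1$, where $\{\psi_m\}$ is a complete orthonormal basis of $\mathbb H$ (not assumed related to $\{\varphi_k\}$). The centered Gaussian noise is $\dot W^Q=\sum_{m=1}^\infty Q^{1/2}\psi_m\,\eta_m$ with $\{\eta_m\}$ independent standard normal random variables. $\mathcal L_2^0$ is the space of Hilbert–Schmidt operators from $Q^{1/2}(\mathbb H)$ to $\mathbb H$, so $\|T\|_{\mathcal L_2^0}^2=\sum_{k}\|TQ^{1/2}\psi_k\|^2$. When $\|A^{(\beta-2)/2}\|_{\mathcal L_2^0}<\infty$, the series for $\dot W^Q$ converges in $L^2(\Omega;\dot{\mathbb H}^{\beta-2})$. Mild solution: an $\mathbb H$-valued random field $u$ with $u=A^{-1}f(u)+A^{-1}\dot W^Q$ almost surely, where $f(u)$ denotes $x\mapsto f(u(x))$. $\mathbb P_N$ ($N\in\mathbb N_+$) is the orthogonal projection onto $\mathrm{span}\{\varphi_1,\dots,\varphi_N\}$ (extended to $\dot{\mathbb H}^s$, $s<0$, by truncating the expansion in the $\varphi_k$), so $\mathbb P_N\dot W^Q=\sum_{m=1}^N\big(\sum_{k\ge1}(Q^{1/2}\psi_k,\varphi_m)\eta_k\big)\varphi_m$. The equation for $u_N^h$ holds almost surely. Finite elements: $\{\mathcal T_h\}$ is a quasiuniform family of triangulations of $\mathscr O$ with meshsize $h\in(0,1)$, and $V_h\subset\mathbb H^1_0$ is a finite element space of continuous piecewise polynomials of degree $r$ ($r\ge1$) with the approximation property $\inf_{v_h\in V_h}\|v-v_h\|_{\mathbb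 H^{s}}\le Ch^{k-s}\|v\|_{\mathbb H^k}$ for $v\in\mathbb H^k$ (satisfying the boundary condition), $s\le k\le r+1$. The Ritz projection $\mathcal R_h:\mathbb H^1_0\to V_h$, defined by $(\nabla\mathcal R_hw,\nabla v)=(\nabla w,\nabla v)$ for all $v\in V_h$, is taken to satisfy the standard estimate $\|w-\mathcal R_hw\|\le Ch^{k}\|w\|_{\mathbb H^{k}}$ for $w\in\mathbb H^1_0\cap\mathbb H^{k}$, for $k=r+1$ and for $k=2$. $C$ denotes a generic positive constant independent of $N$ and $h$, which may differ from one place to another. *)

theory Defs
  imports "HOL-Probability.Probability"
begin

section \<open>Square integrable functions on a domain\<close>

text \<open>
  Elements of \<open>L\<^sup>2(D)\<close> are represented by functions on the whole space; only their values on
  \<open>D\<close>, up to null sets, matter.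
\<close>

definition L2 :: "'a::euclidean_space set \<Rightarrow> ('a \<Rightarrow> real) set" where
  "L2 D = {v \<in> borel_measurable (lebesgue_on D). integrable (lebesgue_on D) (\<lambda>x. (v x)\<^sup>2)}"

definition ip :: "'a::euclidean_space set \<Rightarrow> ('a \<Rightarrow> real) \<Rightarrow> ('a \<Rightarrow> real) \<Rightarrow> real" where
  "ip D v w = (\<integral>x. v x * w x \<partial>lebesgue_on D)"

definition L2norm :: "'a::euclidean_space set \<Rightarrow> ('a \<Rightarrow> real) \<Rightarrow> real" where
  "L2norm D v = sqrt (ip D v v)"

definition eq_ae :: "'a::euclidean_space set \<Rightarrow> ('a \<Rightarrow> real) \<Rightarrow> ('a \<Rightarrow> real) \<Rightarrow> bool" where
  "eq_ae D v w \<longleftrightarrow> (AE x in lebesgue_on D. v x = w x)"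

definition complete_onb :: "'a::euclidean_space set \<Rightarrow> (nat \<Rightarrow> 'a \<Rightarrow> real) \<Rightarrow> bool" where
  "complete_onb D e \<longleftrightarrow>
     (\<forall>k. e k \<in> L2 D) \<and>
     (\<forall>j k. ip D (e j) (e k) = (if j = k then 1 else 0)) \<and>
     (\<forall>v \<in> L2 D. (\<lambda>n. L2norm D (\<lambda>x. v x - (\<Sum>k<n. ip D v (e k) * e k x))) \<longlonglongrightarrow> 0)"

definition linear_subspace :: "('a \<Rightarrow> real) set \<Rightarrow> bool" where
  "linear_subspace V \<longleftrightarrow>
     (\<lambda>x. 0) \<in> V \<and> (\<forall>v\<in>V. \<forall>w\<in>V. \<forall>a b. (\<lambda>x. a * v x + b * w x) \<in> V)"


section \<open>Smooth functions and Sobolev spaces\<close>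

text \<open>
  A partial derivative of order \<open>j\<close> is indexed by a list of \<open>j\<close> basis vectors.
\<close>

definition multi_indices :: "nat \<Rightarrow> 'a::euclidean_space list set" where
  "multi_indices r = {bs. set bs \<subseteq> Basis \<and> length bs \<le> r}"

fun iter_pd :: "'a::euclidean_space list \<Rightarrow> ('a \<Rightarrow> real) \<Rightarrow> 'a \<Rightarrow> real" where
  "iter_pd [] g = g"
| "iter_pd (b # bs) g = (\<lambda>x. frechet_derivative (iter_pd bs g) (at x) b)"

definition smooth :: "('a::euclidean_space \<Rightarrow> real) \<Rightarrow> bool" where
  "smooth g \<longleftrightarrow> (\<forall>bs x. set bs \<subseteq> Basis \<longrightarrow> iter_pd bs g differentiable (at x))"

definition test_functions :: "'a::euclidean_space set \<Rightarrow> ('a \<Rightarrow> real) set" where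
  "test_functions D = {g. smooth g \<and> (\<exists>K. compact K \<and> K \<subseteq> D \<and> (\<forall>x. x \<notin> K \<longrightarrow> g x = 0))}"

definition is_weak_deriv ::
    "'a::euclidean_space set \<Rightarrow> 'a list \<Rightarrow> ('a \<Rightarrow> real) \<Rightarrow> ('a \<Rightarrow> real) \<Rightarrow> bool" where
  "is_weak_deriv D bs v w \<longleftrightarrow>
     w \<in> L2 D \<and> (\<forall>g \<in> test_functions D. ip D v (iter_pd bs g) = (-1) ^ length bs * ip D w g)"

definition weak_deriv ::
    "'a::euclidean_space set \<Rightarrow> 'a list \<Rightarrow> ('a \<Rightarrow> real) \<Rightarrow> 'a \<Rightarrow> real" where
  "weak_deriv D bs v = (SOME w. is_weak_deriv D bs v w)"

definition sobolev :: "'a::euclidean_space set \<Rightarrow> nat \<Rightarrow> ('a \<Rightarrow> real) set" where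
  "sobolev D r = {v \<in> L2 D. \<forall>bs \<in> multi_indices r. \<exists>w. is_weak_deriv D bs v w}"

text \<open>
  Summing over ordered tuples of directions, a mixed derivative is counted once for each ordering:
  the order \<open>j\<close> part is the integral of the squared Frobenius norm of the tensor of \<open>j\<close>-th
  derivatives.
\<close>

definition sobolev_norm :: "'a::euclidean_space set \<Rightarrow> nat \<Rightarrow> ('a \<Rightarrow> real) \<Rightarrow> real" where
  "sobolev_norm D r v = sqrt (\<Sum>bs \<in> multi_indices r. (L2norm D (weak_deriv D bs v))\<^sup>2)"

text \<open>Vanishing on the boundary is understood as membership in the closure of the test functions.\<close>

definition sobolev0 :: "'a::euclidean_space set \<Rightarrow> ('a \<Rightarrow> real) set" where
  "sobolev0 D = {v \<in> sobolev D 1. \<exists>g. (\<forall>n. g n \<in> test_functions D) \<and>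
      (\<lambda>n. sobolev_norm D 1 (\<lambda>x. v x - g n x)) \<longlonglongrightarrow> 0}"

definition grad_ip :: "'a::euclidean_space set \<Rightarrow> ('a \<Rightarrow> real) \<Rightarrow> ('a \<Rightarrow> real) \<Rightarrow> real" where
  "grad_ip D v w = (\<Sum>b\<in>Basis. ip D (weak_deriv D [b] v) (weak_deriv D [b] w))"

definition neg_laplace :: "'a::euclidean_space set \<Rightarrow> ('a \<Rightarrow> real) \<Rightarrow> 'a \<Rightarrow> real" where
  "neg_laplace D v = (\<lambda>x. - (\<Sum>b\<in>Basis. weak_deriv D [b, b] v x))"


section \<open>The domain\<close>

text \<open>
  The boundary consists of finitely many compact pieces of smooth hypersurfaces, and the domain
  lies on one side of its boundary (no slits).
\<close>

definition piecewise_smooth_boundary :: "'a::euclidean_space set \<Rightarrow> bool" where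
  "piecewise_smooth_boundary D \<longleftrightarrow>
     interior (closure D) = D \<and>
     (\<exists>F. finite F \<and> frontier D = \<Union>F \<and>
        (\<forall>S\<in>F. compact S \<and>
           (\<exists>g. smooth g \<and> (\<forall>x\<in>S. g x = 0 \<and> (\<exists>b\<in>Basis. iter_pd [b] g x \<noteq> 0)))))"

definition regular_domain :: "'a::euclidean_space set \<Rightarrow> bool" where
  "regular_domain D \<longleftrightarrow>
     open D \<and> connected D \<and> D \<noteq> {} \<and> bounded D \<and> piecewise_smooth_boundary D"

definition poincare_constant :: "'a::euclidean_space set \<Rightarrow> real \<Rightarrow> bool" where
  "poincare_constant D \<gamma> \<longleftrightarrow> \<gamma> > 0 \<and> (\<forall>v \<in> sobolev0 D. grad_ip D v v \<ge> \<gamma> * (L2norm D v)\<^sup>2)"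


section \<open>The Dirichlet Laplacian and its scale of spaces\<close>

text \<open>
  The graph of \<open>A = -\<Delta>\<close>: the self-adjoint operator in \<open>L\<^sup>2(D)\<close> given by the Dirichlet form.
\<close>

definition dirichlet_laplacian ::
    "'a::euclidean_space set \<Rightarrow> ('a \<Rightarrow> real) \<Rightarrow> ('a \<Rightarrow> real) \<Rightarrow> bool" where
  "dirichlet_laplacian D v g \<longleftrightarrow>
     v \<in> sobolev0 D \<and> g \<in> L2 D \<and> (\<forall>w \<in> sobolev0 D. grad_ip D v w = ip D g w)"

text \<open>Sequences are indexed from \<open>0\<close>: \<open>\<phi> k\<close> and \<open>lam k\<close> are the pair number \<open>k + 1\<close>.\<close>

definition dirichlet_eigensystem ::
    "'a::euclidean_space set \<Rightarrow> (nat \<Rightarrow> real) \<Rightarrow> (nat \<Rightarrow> 'a \<Rightarrow> real) \<Rightarrow> bool" where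
  "dirichlet_eigensystem D lam \<phi> \<longleftrightarrow>
     (\<forall>k. lam k > 0) \<and> mono lam \<and> complete_onb D \<phi> \<and>
     (\<forall>k. dirichlet_laplacian D (\<phi> k) (\<lambda>x. lam k * \<phi> k x))"

definition weyl_law :: "nat \<Rightarrow> (nat \<Rightarrow> real) \<Rightarrow> bool" where
  "weyl_law d lam \<longleftrightarrow>
     (\<exists>C>0. \<forall>k. inverse C * real (k + 1) powr (2 / real d) \<le> lam k \<and>
                 lam k \<le> C * real (k + 1) powr (2 / real d))"

text \<open>
  A formal series in the eigenfunctions is represented by its coefficient sequence; an
  \<open>L\<^sup>2\<close>-function enters through its Fourier coefficients \<open>coeffs\<close>.
\<close>

definition coeffs ::
    "'a::euclidean_space set \<Rightarrow> (nat \<Rightarrow> 'a \<Rightarrow> real) \<Rightarrow> ('a \<Rightarrow> real) \<Rightarrow> nat \<Rightarrow> real" where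
  "coeffs D \<phi> v = (\<lambda>k. ip D v (\<phi> k))"

definition dotH :: "(nat \<Rightarrow> real) \<Rightarrow> real \<Rightarrow> (nat \<Rightarrow> real) set" where
  "dotH lam s = {c. summable (\<lambda>k. lam k powr s * (c k)\<^sup>2)}"

definition dotH_norm :: "(nat \<Rightarrow> real) \<Rightarrow> real \<Rightarrow> (nat \<Rightarrow> real) \<Rightarrow> real" where
  "dotH_norm lam s c = sqrt (\<Sum>k. lam k powr s * (c k)\<^sup>2)"

definition A_pow :: "(nat \<Rightarrow> real) \<Rightarrow> real \<Rightarrow> (nat \<Rightarrow> real) \<Rightarrow> nat \<Rightarrow> real" where
  "A_pow lam s c = (\<lambda>k. lam k powr s * c k)"

text \<open>
  The identification of the spectral space of integer order \<open>s\<close> with the Sobolev space of order \<open>s\<close>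
  with additional boundary conditions, which are \<open>(-\<Delta>)\<^sup>j v = 0\<close> on the boundary whenever
  \<open>2 j < s\<close>. It is an assumption on the regularity of the domain.
\<close>

definition dotH_is_sobolev ::
    "'a::euclidean_space set \<Rightarrow> (nat \<Rightarrow> real) \<Rightarrow> (nat \<Rightarrow> 'a \<Rightarrow> real) \<Rightarrow> nat \<Rightarrow> bool" where
  "dotH_is_sobolev D lam \<phi> s \<longleftrightarrow>
     (\<forall>v \<in> L2 D. coeffs D \<phi> v \<in> dotH lam (real s) \<longleftrightarrow>
        v \<in> sobolev D s \<and> (\<forall>j. 2 * j < s \<longrightarrow> (neg_laplace D ^^ j) v \<in> sobolev0 D)) \<and>
     (\<exists>C>0. \<forall>v \<in> L2 D. coeffs D \<phi> v \<in> dotH lam (real s) \<longrightarrow>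
        sobolev_norm D s v \<le> C * dotH_norm lam (real s) (coeffs D \<phi> v) \<and>
        dotH_norm lam (real s) (coeffs D \<phi> v) \<le> C * sobolev_norm D s v)"


section \<open>The noise\<close>

text \<open>The operator may be unbounded; \<open>dm\<close> is its domain.\<close>

definition nonneg_selfadjoint ::
    "'a::euclidean_space set \<Rightarrow> ('a \<Rightarrow> real) set \<Rightarrow> (('a \<Rightarrow> real) \<Rightarrow> 'a \<Rightarrow> real) \<Rightarrow> bool" where
  "nonneg_selfadjoint D dm Q \<longleftrightarrow>
     dm \<subseteq> L2 D \<and> linear_subspace dm \<and>
     (\<forall>v \<in> L2 D. \<forall>\<epsilon>>0. \<exists>w\<in>dm. L2norm D (\<lambda>x. v x - w x) < \<epsilon>) \<and>
     (\<forall>v\<in>dm. Q v \<in> L2 D) \<and>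
     (\<forall>v\<in>dm. \<forall>w\<in>dm. \<forall>a b. eq_ae D (Q (\<lambda>x. a * v x + b * w x)) (\<lambda>x. a * Q v x + b * Q w x)) \<and>
     (\<forall>v\<in>dm. \<forall>w\<in>dm. ip D (Q v) w = ip D v (Q w)) \<and>
     (\<forall>v \<in> L2 D. \<forall>w \<in> L2 D. (\<forall>z\<in>dm. ip D (Q z) v = ip D z w) \<longrightarrow> v \<in> dm \<and> eq_ae D (Q v) w) \<and>
     (\<forall>v\<in>dm. ip D (Q v) v \<ge> 0)"

definition covariance_eigensystem ::
    "'a::euclidean_space set \<Rightarrow> ('a \<Rightarrow> real) set \<Rightarrow> (('a \<Rightarrow> real) \<Rightarrow> 'a \<Rightarrow> real) \<Rightarrow>
     (nat \<Rightarrow> real) \<Rightarrow> (nat \<Rightarrow> 'a \<Rightarrow> real) \<Rightarrow> bool" where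
  "covariance_eigensystem D dm Q \<sigma> \<psi> \<longleftrightarrow>
     nonneg_selfadjoint D dm Q \<and> complete_onb D \<psi> \<and>
     (\<forall>m. \<psi> m \<in> dm \<and> eq_ae D (Q (\<psi> m)) (\<lambda>x. \<sigma> m * \<psi> m x))"

text \<open>\<open>Q\<^sup>1\<^sup>/\<^sup>2 \<psi>\<^sub>m\<close>, by functional calculus.\<close>

definition sqrtQ :: "(nat \<Rightarrow> real) \<Rightarrow> (nat \<Rightarrow> 'a \<Rightarrow> real) \<Rightarrow> nat \<Rightarrow> 'a \<Rightarrow> real" where
  "sqrtQ \<sigma> \<psi> m = (\<lambda>x. sqrt (\<sigma> m) * \<psi> m x)"

text \<open>
  The Hilbert-Schmidt norm of \<open>A\<^sup>s\<close> from the range of \<open>Q\<^sup>1\<^sup>/\<^sup>2\<close> to \<open>L\<^sup>2(D)\<close>, and its finiteness.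
\<close>

definition HS_finite ::
    "'a::euclidean_space set \<Rightarrow> (nat \<Rightarrow> real) \<Rightarrow> (nat \<Rightarrow> 'a \<Rightarrow> real) \<Rightarrow>
     (nat \<Rightarrow> real) \<Rightarrow> (nat \<Rightarrow> 'a \<Rightarrow> real) \<Rightarrow> real \<Rightarrow> bool" where
  "HS_finite D lam \<phi> \<sigma> \<psi> s \<longleftrightarrow>
     (\<forall>m. A_pow lam s (coeffs D \<phi> (sqrtQ \<sigma> \<psi> m)) \<in> dotH lam 0) \<and>
     summable (\<lambda>m. (dotH_norm lam 0 (A_pow lam s (coeffs D \<phi> (sqrtQ \<sigma> \<psi> m))))\<^sup>2)"

definition HS_norm ::
    "'a::euclidean_space set \<Rightarrow> (nat \<Rightarrow> real) \<Rightarrow> (nat \<Rightarrow> 'a \<Rightarrow> real) \<Rightarrow>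
     (nat \<Rightarrow> real) \<Rightarrow> (nat \<Rightarrow> 'a \<Rightarrow> real) \<Rightarrow> real \<Rightarrow> real" where
  "HS_norm D lam \<phi> \<sigma> \<psi> s =
     sqrt (\<Sum>m. (dotH_norm lam 0 (A_pow lam s (coeffs D \<phi> (sqrtQ \<sigma> \<psi> m))))\<^sup>2)"

definition iid_std_normal :: "'w measure \<Rightarrow> (nat \<Rightarrow> 'w \<Rightarrow> real) \<Rightarrow> bool" where
  "iid_std_normal M \<eta> \<longleftrightarrow>
     prob_space.indep_vars M (\<lambda>_. borel) \<eta> UNIV \<and>
     (\<forall>m. distributed M lborel (\<eta> m) std_normal_density)"

text \<open>
  \<open>W\<close>, given by its coefficients, is the sum of \<open>\<Sum>m. \<eta>\<^sub>m Q\<^sup>1\<^sup>/\<^sup>2 \<psi>\<^sub>m\<close> in the space of square integrable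
  random variables with values in \<open>dotH lam s\<close>.
\<close>

definition noise ::
    "'w measure \<Rightarrow> 'a::euclidean_space set \<Rightarrow> (nat \<Rightarrow> real) \<Rightarrow> (nat \<Rightarrow> 'a \<Rightarrow> real) \<Rightarrow>
     (nat \<Rightarrow> real) \<Rightarrow> (nat \<Rightarrow> 'a \<Rightarrow> real) \<Rightarrow> (nat \<Rightarrow> 'w \<Rightarrow> real) \<Rightarrow> real \<Rightarrow>
     ('w \<Rightarrow> nat \<Rightarrow> real) \<Rightarrow> bool" where
  "noise M D lam \<phi> \<sigma> \<psi> \<eta> s W \<longleftrightarrow>
     (\<forall>k. (\<lambda>\<omega>. W \<omega> k) \<in> borel_measurable M) \<and>
     (AE \<omega> in M. W \<omega> \<in> dotH lam s) \<and>
     (\<lambda>n. \<integral>\<^sup>+\<omega>. ennreal ((dotH_norm lam s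
            (\<lambda>k. (\<Sum>m<n. \<eta> m \<omega> * coeffs D \<phi> (sqrtQ \<sigma> \<psi> m) k) - W \<omega> k))\<^sup>2) \<partial>M) \<longlonglongrightarrow> 0"

definition spectral_proj ::
    "(nat \<Rightarrow> 'a \<Rightarrow> real) \<Rightarrow> nat \<Rightarrow> (nat \<Rightarrow> real) \<Rightarrow> 'a \<Rightarrow> real" where
  "spectral_proj \<phi> N c = (\<lambda>x. \<Sum>k<N. c k * \<phi> k x)"


section \<open>Finite elements\<close>

definition poly_of_degree_le :: "nat \<Rightarrow> ('a::euclidean_space \<Rightarrow> real) \<Rightarrow> bool" where
  "poly_of_degree_le r q \<longleftrightarrow>
     (\<exists>c. \<forall>x. q x = (\<Sum>bs \<in> multi_indices r. c bs * prod_list (map (\<lambda>b. x \<bullet> b) bs)))"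

text \<open>
  The union of the simplices is \<open>closure D\<close> for a polyhedral domain. For a domain with curved
  boundary it is a polyhedron inside \<open>closure D\<close> whose boundary nodes lie on the boundary of \<open>D\<close>;
  finite element functions then vanish outside of it.
\<close>

definition mesh :: "'a::euclidean_space set \<Rightarrow> 'a set set \<Rightarrow> bool" where
  "mesh D \<T> \<longleftrightarrow>
     triangulation \<T> \<and> \<T> \<noteq> {} \<and> (\<forall>K\<in>\<T>. int DIM('a) simplex K) \<and>
     \<Union>\<T> \<subseteq> closure D \<and>
     (\<forall>K\<in>\<T>. \<forall>x. x extreme_point_of K \<and> x \<in> frontier (\<Union>\<T>) \<longrightarrow> x \<in> frontier D)"

definition quasiuniform_family ::
    "'a::euclidean_space set \<Rightarrow> real set \<Rightarrow> (real \<Rightarrow> 'a set set) \<Rightarrow> bool" where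
  "quasiuniform_family D H \<T> \<longleftrightarrow>
     H \<subseteq> {0<..<1} \<and>
     (\<forall>h\<in>H. mesh D (\<T> h) \<and> h = Max (diameter ` \<T> h)) \<and>
     (\<exists>\<rho>>0. \<forall>h\<in>H. \<forall>K \<in> \<T> h. \<exists>x. ball x (\<rho> * h) \<subseteq> K)"

definition piecewise_polys ::
    "'a::euclidean_space set \<Rightarrow> 'a set set \<Rightarrow> nat \<Rightarrow> ('a \<Rightarrow> real) set" where
  "piecewise_polys D \<T> r =
     {v. continuous_on UNIV v \<and> (\<forall>x. x \<notin> D \<inter> \<Union>\<T> \<longrightarrow> v x = 0) \<and>
         (\<forall>K\<in>\<T>. \<exists>q. poly_of_degree_le r q \<and> (\<forall>x\<in>K. v x = q x))}"

definition fe_space ::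
    "'a::euclidean_space set \<Rightarrow> 'a set set \<Rightarrow> nat \<Rightarrow> ('a \<Rightarrow> real) set \<Rightarrow> bool" where
  "fe_space D \<T> r V \<longleftrightarrow> linear_subspace V \<and> V \<subseteq> piecewise_polys D \<T> r \<and> V \<subseteq> sobolev0 D"

text \<open>The functions in \<open>V h\<close> are only in the Sobolev spaces of orders \<open>s \<le> 1\<close>.\<close>

definition approximation_property ::
    "'a::euclidean_space set \<Rightarrow> real set \<Rightarrow> nat \<Rightarrow> (real \<Rightarrow> ('a \<Rightarrow> real) set) \<Rightarrow> bool" where
  "approximation_property D H r V \<longleftrightarrow>
     (\<exists>C>0. \<forall>h\<in>H. \<forall>k s. 1 \<le> k \<and> k \<le> r + 1 \<and> s \<le> k \<and> s \<le> 1 \<longrightarrow>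
        (\<forall>v \<in> sobolev D k \<inter> sobolev0 D.
           (INF vh \<in> V h. sobolev_norm D s (\<lambda>x. v x - vh x)) \<le> C * h ^ (k - s) * sobolev_norm D k v))"

definition ritz_projection ::
    "'a::euclidean_space set \<Rightarrow> ('a \<Rightarrow> real) set \<Rightarrow> (('a \<Rightarrow> real) \<Rightarrow> 'a \<Rightarrow> real) \<Rightarrow> bool" where
  "ritz_projection D V R \<longleftrightarrow>
     (\<forall>w \<in> sobolev0 D. R w \<in> V \<and> (\<forall>v\<in>V. grad_ip D (R w) v = grad_ip D w v))"

definition ritz_estimate ::
    "'a::euclidean_space set \<Rightarrow> real set \<Rightarrow> (real \<Rightarrow> ('a \<Rightarrow> real) \<Rightarrow> 'a \<Rightarrow> real) \<Rightarrow> nat \<Rightarrow> bool" where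
  "ritz_estimate D H R k \<longleftrightarrow>
     (\<exists>C>0. \<forall>h\<in>H. \<forall>w \<in> sobolev0 D \<inter> sobolev D k.
        L2norm D (\<lambda>x. w x - R h w x) \<le> C * h ^ k * sobolev_norm D k w)"


section \<open>The equation and its discretization\<close>

definition lip_seminorm :: "(real \<Rightarrow> real) \<Rightarrow> real" where
  "lip_seminorm f = Sup {\<bar>f x - f y\<bar> / \<bar>x - y\<bar> | x y. x \<noteq> y}"

text \<open>Bounded derivatives of the orders \<open>1, \<dots>, n\<close>; \<open>f\<close> itself need not be bounded.\<close>

definition bounded_derivs_upto :: "nat \<Rightarrow> (real \<Rightarrow> real) \<Rightarrow> bool" where
  "bounded_derivs_upto n f \<longleftrightarrow>
     (\<forall>j<n. (\<forall>x. (deriv ^^ j) f differentiable (at x)) \<and> bounded (range ((deriv ^^ Suc j) f)))"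

text \<open>
  As \<open>L\<^sup>2(D)\<close> is separable, Borel measurability of an \<open>L\<^sup>2(D)\<close>-valued map is the same as
  measurability of its inner products with fixed elements.
\<close>

definition L2_random_variable ::
    "'w measure \<Rightarrow> 'a::euclidean_space set \<Rightarrow> ('w \<Rightarrow> 'a \<Rightarrow> real) \<Rightarrow> bool" where
  "L2_random_variable M D u \<longleftrightarrow>
     (\<forall>\<omega> \<in> space M. u \<omega> \<in> L2 D) \<and>
     (\<forall>g \<in> L2 D. (\<lambda>\<omega>. ip D (u \<omega>) g) \<in> borel_measurable M)"

definition mild_solution ::
    "'w measure \<Rightarrow> 'a::euclidean_space set \<Rightarrow> (nat \<Rightarrow> real) \<Rightarrow> (nat \<Rightarrow> 'a \<Rightarrow> real) \<Rightarrow>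
     (real \<Rightarrow> real) \<Rightarrow> ('w \<Rightarrow> nat \<Rightarrow> real) \<Rightarrow> ('w \<Rightarrow> 'a \<Rightarrow> real) \<Rightarrow> bool" where
  "mild_solution M D lam \<phi> f W u \<longleftrightarrow>
     L2_random_variable M D u \<and>
     (AE \<omega> in M. \<forall>k. coeffs D \<phi> (u \<omega>) k =
        A_pow lam (-1) (coeffs D \<phi> (\<lambda>x. f (u \<omega> x))) k + A_pow lam (-1) (W \<omega>) k)"

definition fe_solution ::
    "'w measure \<Rightarrow> 'a::euclidean_space set \<Rightarrow> (nat \<Rightarrow> 'a \<Rightarrow> real) \<Rightarrow> (real \<Rightarrow> real) \<Rightarrow>
     ('w \<Rightarrow> nat \<Rightarrow> real) \<Rightarrow> nat \<Rightarrow> ('a \<Rightarrow> real) set \<Rightarrow> ('w \<Rightarrow> 'a \<Rightarrow> real) \<Rightarrow> bool" where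
  "fe_solution M D \<phi> f W N V U \<longleftrightarrow>
     L2_random_variable M D U \<and> (\<forall>\<omega> \<in> space M. U \<omega> \<in> V) \<and>
     (AE \<omega> in M. \<forall>v\<in>V. grad_ip D (U \<omega>) v =
        ip D (\<lambda>x. f (U \<omega> x)) v + ip D (spectral_proj \<phi> N (W \<omega>)) v)"

text \<open>
  \<open>(E \<parallel>u - v\<parallel>\<^sup>p)\<^sup>1\<^sup>/\<^sup>p \<le> B\<close>. Integrability is part of the claim, as the Bochner integral of a
  non-integrable function is \<open>0\<close>.
\<close>

definition Lp_error_le ::
    "'w measure \<Rightarrow> 'a::euclidean_space set \<Rightarrow> real \<Rightarrow> ('w \<Rightarrow> 'a \<Rightarrow> real) \<Rightarrow> ('w \<Rightarrow> 'a \<Rightarrow> real) \<Rightarrow>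
     real \<Rightarrow> bool" where
  "Lp_error_le M D p u v B \<longleftrightarrow>
     integrable M (\<lambda>\<omega>. L2norm D (\<lambda>x. u \<omega> x - v \<omega> x) powr p) \<and>
     (\<integral>\<omega>. L2norm D (\<lambda>x. u \<omega> x - v \<omega> x) powr p \<partial>M) powr (1 / p) \<le> B"

end

theory Submission
  imports Defs
begin

text \<open>
  Fix a sample \<open>\<omega>\<close> and write \<open>g = f(u)\<close>, \<open>X\<close> for the norm of the noise in the
  spectral space of order \<open>\<beta> - 2\<close>, \<open>L < \<gamma>\<close> for the Lipschitz constant of \<open>f\<close> and \<open>P\<^sub>n\<close> for
  the projection onto the first \<open>n\<close> eigenfunctions. The solution \<open>u\<close> is compared with
  \<open>w = A\<^sup>-\<^sup>1(P\<^sub>n g + P\<^sub>N W)\<close>, where \<open>n\<close> tends to infinity in the end, and \<open>w\<close> with its Ritz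
  projection \<open>R w\<close>:

  \<^item> \<open>u - w\<close> consists of the noise modes from \<open>N\<close> on, divided by their eigenvalues, up to a
    remainder that vanishes as \<open>n\<close> grows. Its norm is at most \<open>\<lambda>\<^sub>N\<close> to the power \<open>-\<beta>/2\<close>, times \<open>X\<close>.

  \<^item> \<open>A w = P\<^sub>n g + P\<^sub>N W\<close> is square integrable, so \<open>w - R w\<close> is of the order \<open>h\<^sup>2 \<parallel>A w\<parallel>\<close>. The
    noise part of \<open>A w\<close> has at most the norm \<open>X\<close> times the \<open>N\<close>-th eigenvalue to the power
    \<open>(2-\<beta>)/2\<close>, and \<open>\<parallel>g\<parallel>\<close> is at most a constant times \<open>1 + X\<close> by the a priori estimate for the mild solution.

  \<^item> \<open>e = R w - u\<^sub>h\<close> is a finite element function, and the noise cancels in its equation: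
    \<open>(\<nabla>e, \<nabla>v) = (P\<^sub>n g - f(u\<^sub>h), v)\<close>. Testing with \<open>e\<close> itself and using the Poincare inequality,
    \<open>\<gamma> \<parallel>e\<parallel>\<close> is at most \<open>L \<parallel>u - u\<^sub>h\<parallel>\<close> plus the remainder \<open>\<parallel>g - P\<^sub>n g\<parallel>\<close>. As \<open>L < \<gamma>\<close>, this term
    is absorbed into the left-hand side.

  Weyl's law turns powers of eigenvalues into powers of \<open>N\<close>, which gives the pathwise bound
  \<open>\<parallel>u - u\<^sub>h\<parallel> \<le> C (N\<^sup>-\<^sup>\<beta>\<^sup>/\<^sup>d + h\<^sup>2 N\<^sup>(\<^sup>2\<^sup>-\<^sup>\<beta>\<^sup>)\<^sup>/\<^sup>d) (1 + X)\<close> of \<open>pathwise_rate\<close>. It remains to see that \<open>X\<close> has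
  moments of all orders. Each mode of the noise is a limit of centred Gaussian variables, so its
  moments are controlled by its variance, and convexity passes from the modes to their weighted sum
  of squares (\<open>noise_moments_finite\<close>).

  The second bound is a consequence of the first: with \<open>x = h N\<^sup>1\<^sup>/\<^sup>d\<close> the two rates are
  \<open>N\<^sup>-\<^sup>\<beta>\<^sup>/\<^sup>d (1 + x\<^sup>2)\<close> and \<open>N\<^sup>-\<^sup>\<beta>\<^sup>/\<^sup>d (1 + x\<^sup>r\<^sup>+\<^sup>1)\<close> (\<open>rate_mono\<close>).

  Working with finite sums \<open>w\<close> of eigenfunctions keeps the functional analysis elementary: the
  Dirichlet form of \<open>w\<close> is computed term by term, and no function has to be constructed from
  its Fourier coefficients.
\<close>

section \<open>Square integrable functions\<close>

lemma L2_mult_integrable: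
  assumes "v \<in> L2 D" "w \<in> L2 D"
  shows "integrable (lebesgue_on D) (\<lambda>x. v x * w x)"
proof (rule Bochner_Integration.integrable_bound)
  show "integrable (lebesgue_on D) (\<lambda>x. (v x)\<^sup>2 + (w x)\<^sup>2)"
    using assms by (auto simp: L2_def)
  show "(\<lambda>x. v x * w x) \<in> borel_measurable (lebesgue_on D)"
    using assms by (auto simp: L2_def)
  have "\<bar>v x * w x\<bar> \<le> (v x)\<^sup>2 + (w x)\<^sup>2" for x
    using sum_squares_bound[of "\<bar>v x\<bar>" "\<bar>w x\<bar>"] mult_nonneg_nonneg[of "\<bar>v x\<bar>" "\<bar>w x\<bar>"]
    unfolding abs_mult power2_abs by linarith
  then show "AE x in lebesgue_on D. norm (v x * w x) \<le> norm ((v x)\<^sup>2 + (w x)\<^sup>2)"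
    by (auto intro: order_trans[OF _ abs_ge_self])
qed

lemma L2_lincomb:
  assumes "v \<in> L2 D" "w \<in> L2 D"
  shows "(\<lambda>x. a * v x + b * w x) \<in> L2 D"
proof -
  have "integrable (lebesgue_on D) (\<lambda>x. a\<^sup>2 * (v x)\<^sup>2 + 2 * a * b * (v x * w x) + b\<^sup>2 * (w x)\<^sup>2)"
    using assms L2_mult_integrable[OF assms] by (auto simp: L2_def)
  also have "(\<lambda>x. a\<^sup>2 * (v x)\<^sup>2 + 2 * a * b * (v x * w x) + b\<^sup>2 * (w x)\<^sup>2)
      = (\<lambda>x. (a * v x + b * w x)\<^sup>2)"
    by (auto simp: power2_eq_square algebra_simps)
  finally show ?thesis using assms by (auto simp: L2_def)
qed

lemma L2_zero: "(\<lambda>x. 0) \<in> L2 D"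
  by (simp add: L2_def)

lemma L2_diff: "v \<in> L2 D \<Longrightarrow> w \<in> L2 D \<Longrightarrow> (\<lambda>x. v x - w x) \<in> L2 D"
  using L2_lincomb[of v D w 1 "-1"] by simp

lemma L2_sum:
  fixes c :: "nat \<Rightarrow> real"
  assumes "\<And>k. e k \<in> L2 D"
  shows "(\<lambda>x. \<Sum>k<n. c k * e k x) \<in> L2 D"
proof (induction n)
  case (Suc n)
  then show ?case using L2_lincomb[OF Suc assms[of n], of 1 "c n"] by simp
qed (simp add: L2_zero)

lemma ip_commute: "ip D v w = ip D w v"
  by (simp add: ip_def mult.commute)

lemma ip_zero_left [simp]: "ip D (\<lambda>x. 0) w = 0"
  by (simp add: ip_def)

lemma ip_lincomb_left:
  assumes "v \<in> L2 D" "w \<in> L2 D" "z \<in> L2 D"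
  shows "ip D (\<lambda>x. a * v x + b * w x) z = a * ip D v z + b * ip D w z"
proof -
  have "ip D (\<lambda>x. a * v x + b * w x) z
      = (\<integral>x. a * (v x * z x) + b * (w x * z x) \<partial>lebesgue_on D)"
    unfolding ip_def by (simp add: algebra_simps)
  also have "\<dots> = a * ip D v z + b * ip D w z"
    unfolding ip_def using L2_mult_integrable[OF assms(1,3)] L2_mult_integrable[OF assms(2,3)]
    by simp
  finally show ?thesis .
qed

lemma ip_cmult_left:
  assumes "v \<in> L2 D" "z \<in> L2 D"
  shows "ip D (\<lambda>x. a * v x) z = a * ip D v z"
  using ip_lincomb_left[OF assms(1,1,2), of a 0] by simp

lemma ip_diff_left:
  assumes "v \<in> L2 D" "w \<in> L2 D" "z \<in> L2 D"
  shows "ip D (\<lambda>x. v x - w x) z = ip D v z - ip D w z"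
  using ip_lincomb_left[OF assms, of 1 "-1"] by simp

lemma ip_sum_left:
  fixes c :: "nat \<Rightarrow> real"
  assumes "\<And>k. e k \<in> L2 D" "z \<in> L2 D"
  shows "ip D (\<lambda>x. \<Sum>k<n. c k * e k x) z = (\<Sum>k<n. c k * ip D (e k) z)"
proof (induction n)
  case (Suc n)
  then show ?case
    using ip_lincomb_left[OF L2_sum[OF assms(1)] assms(1)[of n] assms(2), where a = 1 and b = "c n"] by simp
qed simp

lemma ip_self_nonneg: "0 \<le> ip D v v"
  by (simp add: ip_def)

lemma L2norm_nonneg [simp]: "0 \<le> L2norm D v"
  by (simp add: L2norm_def ip_self_nonneg)

lemma L2norm_sq: "(L2norm D v)\<^sup>2 = ip D v v"
  by (simp add: L2norm_def ip_self_nonneg)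

lemma ip_Cauchy_Schwarz:
  assumes "v \<in> L2 D" "w \<in> L2 D"
  shows "\<bar>ip D v w\<bar> \<le> L2norm D v * L2norm D w"
proof -
  let ?a = "ip D v v" and ?b = "ip D v w" and ?c = "ip D w w"
  have *: "0 \<le> ?a + 2 * t * ?b + t\<^sup>2 * ?c" for t
  proof -
    let ?z = "\<lambda>x. 1 * v x + t * w x"
    have z: "?z \<in> L2 D" using assms by (rule L2_lincomb)
    have "0 \<le> ip D ?z ?z" by (rule ip_self_nonneg)
    also have "\<dots> = 1 * ip D v ?z + t * ip D w ?z" by (rule ip_lincomb_left[OF assms z])
    also have "ip D v ?z = 1 * ip D v v + t * ip D w v"
      by (subst ip_commute) (rule ip_lincomb_left[OF assms assms(1)])
    also have "ip D w ?z = 1 * ip D v w + t * ip D w w"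
      by (subst ip_commute) (rule ip_lincomb_left[OF assms assms(2)])
    finally show ?thesis
      by (simp add: ip_commute[of D w v] power2_eq_square algebra_simps)
  qed
  have "?b\<^sup>2 \<le> ?a * ?c"
  proof (cases "?c = 0")
    case True
    have "?b = 0"
    \<comment> \<open>The quadratic polynomial is affine here; at this \<open>t\<close> it would equal \<open>-1\<close>.\<close>
    proof (rule ccontr)
      assume "?b \<noteq> 0"
      with *[of "-(?a + 1) / (2 * ?b)"] True show False by (simp add: field_simps)
    qed
    then show ?thesis using True by simp
  next
    case False
    then have c: "?c > 0" using ip_self_nonneg[of D w] by linarith
    have "0 \<le> ?a - ?b\<^sup>2 / ?c"
      using *[of "- ?b / ?c"] c by (simp add: power2_eq_square field_simps)
    then show ?thesis using c by (simp add: field_simps)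
  qed
  then have "\<bar>?b\<bar> \<le> sqrt (?a * ?c)"
    using real_le_rsqrt by (simp add: power2_eq_square real_le_rsqrt)
  then show ?thesis by (simp add: L2norm_def real_sqrt_mult)
qed

lemma L2norm_triangle:
  assumes "v \<in> L2 D" "w \<in> L2 D"
  shows "L2norm D (\<lambda>x. v x + w x) \<le> L2norm D v + L2norm D w"
proof (rule power2_le_imp_le)
  let ?z = "\<lambda>x. v x + w x"
  have z: "?z \<in> L2 D" using L2_lincomb[OF assms, of 1 1] by simp
  have add: "ip D ?z y = ip D v y + ip D w y" if "y \<in> L2 D" for y
    using ip_lincomb_left[OF assms that, of 1 1] by simp
  have "(L2norm D ?z)\<^sup>2 = ip D ?z v + ip D ?z w"
    using add[OF z] by (simp add: L2norm_sq ip_commute)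
  also have "\<dots> = (L2norm D v)\<^sup>2 + 2 * ip D v w + (L2norm D w)\<^sup>2"
    using add assms by (simp add: L2norm_sq ip_commute[of D w v])
  also have "\<dots> \<le> (L2norm D v + L2norm D w)\<^sup>2"
    using ip_Cauchy_Schwarz[OF assms] by (simp add: power2_sum)
  finally show "(L2norm D ?z)\<^sup>2 \<le> (L2norm D v + L2norm D w)\<^sup>2" .
qed simp

lemma L2norm_zero_ip:
  assumes "v \<in> L2 D" "L2norm D v = 0" "w \<in> L2 D"
  shows "ip D v w = 0"
  using ip_Cauchy_Schwarz[OF assms(1,3)] assms(2) by simp

lemma L2norm_mono:
  assumes "v \<in> L2 D" "w \<in> L2 D" "\<And>x. \<bar>v x\<bar> \<le> c * \<bar>w x\<bar>" "c \<ge> 0"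
  shows "L2norm D v \<le> c * L2norm D w"
proof (rule power2_le_imp_le)
  have "ip D v v \<le> (\<integral>x. c\<^sup>2 * (w x * w x) \<partial>lebesgue_on D)"
    unfolding ip_def
  proof (rule integral_mono)
    show "v x * v x \<le> c\<^sup>2 * (w x * w x)" for x
      using power_mono[OF assms(3), of x 2]
      by (simp add: power_mult_distrib flip: power2_eq_square)
  qed (use assms L2_mult_integrable in auto)
  also have "\<dots> = c\<^sup>2 * ip D w w" by (simp add: ip_def)
  finally show "(L2norm D v)\<^sup>2 \<le> (c * L2norm D w)\<^sup>2"
    by (simp add: L2norm_sq power_mult_distrib)
qed (use assms in simp)

lemma L2_bounded:
  assumes "D \<in> lmeasurable" "v \<in> borel_measurable (lebesgue_on D)" "\<And>x. \<bar>v x\<bar> \<le> B"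
  shows "v \<in> L2 D"
proof -
  have "integrable (lebesgue_on D) (\<lambda>x. (v x)\<^sup>2)"
  proof (rule Bochner_Integration.integrable_bound)
    show "integrable (lebesgue_on D) (\<lambda>x. B\<^sup>2)"
      using finite_measure_lebesgue_on[OF assms(1)] by (simp add: finite_measure.integrable_const)
    show "AE x in lebesgue_on D. norm ((v x)\<^sup>2) \<le> norm (B\<^sup>2)"
      using power_mono[OF assms(3), of _ 2] by simp
  qed (use assms in simp)
  with assms show ?thesis by (simp add: L2_def)
qed

lemma L2_Lipschitz_comp:
  assumes D: "D \<in> lmeasurable" and f: "\<And>x y. \<bar>f x - f y\<bar> \<le> L * \<bar>x - y\<bar>" and v: "v \<in> L2 D"
  shows "(\<lambda>x. f (v x)) \<in> L2 D"
    and "L2norm D (\<lambda>x. f (v x)) \<le> L * L2norm D v + L2norm D (\<lambda>x. f 0)"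
proof -
  have L: "0 \<le> L" using f[of 1 0] abs_ge_zero[of "f 1 - f 0"] by simp
  have "L-lipschitz_on UNIV f"
    using f L by (auto simp: lipschitz_on_def dist_real_def)
  then have "continuous_on UNIV f" by (rule lipschitz_on_continuous_on)
  then have [measurable]: "f \<in> borel_measurable borel" by (rule borel_measurable_continuous_onI)
  have [measurable]: "v \<in> borel_measurable (lebesgue_on D)" using v by (simp add: L2_def)
  let ?d = "\<lambda>x. f (v x) - f 0"
  have c: "(\<lambda>x. f 0) \<in> L2 D" by (rule L2_bounded[OF D, of _ "\<bar>f 0\<bar>"]) auto
  have d: "?d \<in> L2 D"
  proof -
    have "integrable (lebesgue_on D) (\<lambda>x. (?d x)\<^sup>2)"
    proof (rule Bochner_Integration.integrable_bound)
      show "integrable (lebesgue_on D) (\<lambda>x. L\<^sup>2 * (v x)\<^sup>2)" using v by (simp add: L2_def)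
      show "AE x in lebesgue_on D. norm ((?d x)\<^sup>2) \<le> norm (L\<^sup>2 * (v x)\<^sup>2)"
        using power_mono[OF f[of _ 0], of _ 2] by (simp add: power_mult_distrib)
    qed simp
    then show ?thesis by (simp add: L2_def)
  qed
  show "(\<lambda>x. f (v x)) \<in> L2 D" using L2_lincomb[OF d c, of 1 1] by simp
  have "L2norm D ?d \<le> L * L2norm D v"
    using f[of _ 0] L by (intro L2norm_mono[OF d v]) auto
  then show "L2norm D (\<lambda>x. f (v x)) \<le> L * L2norm D v + L2norm D (\<lambda>x. f 0)"
    using L2norm_triangle[OF d c] by simp
qed


section \<open>Expansion in an orthonormal basis\<close>

lemma onb_L2: "complete_onb D e \<Longrightarrow> e k \<in> L2 D"
  by (simp add: complete_onb_def)

lemma onb_ip: "complete_onb D e \<Longrightarrow> ip D (e j) (e k) = (if j = k then 1 else 0)"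
  by (simp add: complete_onb_def)

lemma coeffs_sum:
  fixes c :: "nat \<Rightarrow> real"
  assumes "complete_onb D e"
  shows "coeffs D e (\<lambda>x. \<Sum>k<n. c k * e k x) j = (if j < n then c j else 0)"
proof -
  have "coeffs D e (\<lambda>x. \<Sum>k<n. c k * e k x) j = (\<Sum>k<n. c k * ip D (e k) (e j))"
    unfolding coeffs_def using assms by (intro ip_sum_left onb_L2)
  also have "\<dots> = (\<Sum>k<n. if k = j then c j else 0)"
    by (intro sum.cong) (auto simp: onb_ip[OF assms])
  finally show ?thesis by simp
qed

lemma coeffs_diff:
  assumes "complete_onb D e" "v \<in> L2 D" "w \<in> L2 D"
  shows "coeffs D e (\<lambda>x. v x - w x) k = coeffs D e v k - coeffs D e w k"
  unfolding coeffs_def by (rule ip_diff_left[OF assms(2,3) onb_L2[OF assms(1)]])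

lemma L2norm_sq_minus_spectral_proj:
  assumes e: "complete_onb D e" and v: "v \<in> L2 D"
  shows "(L2norm D (\<lambda>x. v x - spectral_proj e n (coeffs D e v) x))\<^sup>2
      = (L2norm D v)\<^sup>2 - (\<Sum>k<n. (coeffs D e v k)\<^sup>2)"
proof -
  let ?c = "coeffs D e v"
  let ?P = "spectral_proj e n ?c"
  have P: "?P \<in> L2 D" unfolding spectral_proj_def by (intro L2_sum onb_L2[OF e])
  have ipP: "ip D ?P z = (\<Sum>k<n. ?c k * coeffs D e z k)" if "z \<in> L2 D" for z
    unfolding spectral_proj_def
    by (subst ip_sum_left[OF onb_L2[OF e] that]) (simp add: coeffs_def ip_commute)
  have "(L2norm D (\<lambda>x. v x - ?P x))\<^sup>2
      = ip D v (\<lambda>x. v x - ?P x) - ip D ?P (\<lambda>x. v x - ?P x)"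
    unfolding L2norm_sq by (rule ip_diff_left[OF v P L2_diff[OF v P]])
  also have "ip D v (\<lambda>x. v x - ?P x) = ip D v v - ip D ?P v"
    by (simp only: ip_commute[of D v "\<lambda>x. v x - ?P x"] ip_diff_left[OF v P v])
  also have "ip D ?P (\<lambda>x. v x - ?P x) = ip D ?P v - ip D ?P ?P"
    by (simp only: ip_commute[of D ?P "\<lambda>x. v x - ?P x"] ip_diff_left[OF v P P] ip_commute[of D v ?P])
  also have "ip D ?P ?P = ip D ?P v"
    unfolding ipP[OF P] ipP[OF v]
    by (intro sum.cong) (auto simp: spectral_proj_def coeffs_sum[OF e])
  finally show ?thesis
    by (simp add: L2norm_sq[of D v] ipP[OF v] flip: power2_eq_square)
qed

lemma Parseval:
  assumes "complete_onb D e" "v \<in> L2 D"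
  shows "(\<lambda>k. (coeffs D e v k)\<^sup>2) sums (L2norm D v)\<^sup>2"
proof -
  have "(\<lambda>n. L2norm D (\<lambda>x. v x - spectral_proj e n (coeffs D e v) x)) \<longlonglongrightarrow> 0"
    using assms by (simp add: complete_onb_def spectral_proj_def coeffs_def)
  then have "(\<lambda>n. (L2norm D v)\<^sup>2 - (L2norm D (\<lambda>x. v x - spectral_proj e n (coeffs D e v) x))\<^sup>2)
      \<longlonglongrightarrow> (L2norm D v)\<^sup>2 - 0\<^sup>2"
    by (intro tendsto_intros)
  then show ?thesis
    unfolding sums_def by (simp add: L2norm_sq_minus_spectral_proj[OF assms])
qed

lemma Bessel:
  assumes "complete_onb D e" "v \<in> L2 D"
  shows "(\<Sum>k<n. (coeffs D e v k)\<^sup>2) \<le> (L2norm D v)\<^sup>2"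
  using L2norm_sq_minus_spectral_proj[OF assms, of n] 
  by (smt (verit) zero_le_power2)

text \<open>
  Norms are estimated through finite sections of the coefficient sequence, whose Euclidean norm
  obeys Minkowski's inequality. This gives the triangle inequality with constant \<open>1\<close>, which the
  absorption argument needs, also for sequences that are not known to come from a function.
\<close>

lemma L2norm_le_of_partial_sums:
  assumes "complete_onb D e" "v \<in> L2 D" "\<And>n. L2_set (coeffs D e v) {..<n} \<le> B"
  shows "L2norm D v \<le> B"
proof (rule power2_le_imp_le)
  show B: "0 \<le> B" using assms(3)[of 0] by simp
  show "(L2norm D v)\<^sup>2 \<le> B\<^sup>2"
  proof (rule LIMSEQ_le_const2)
    show "(\<lambda>n. \<Sum>k<n. (coeffs D e v k)\<^sup>2) \<longlonglongrightarrow> (L2norm D v)\<^sup>2"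
      using Parseval[OF assms(1,2)] by (simp add: sums_def)
    show "\<exists>N. \<forall>n\<ge>N. (\<Sum>k<n. (coeffs D e v k)\<^sup>2) \<le> B\<^sup>2"
      using power_mono[OF assms(3) L2_set_nonneg, of _ 2] 
      by (simp add: L2_set_def sum_nonneg)
  qed
qed

section \<open>Weak derivatives\<close>

lemma iter_pd_differentiable:
  "g \<in> test_functions D \<Longrightarrow> set bs \<subseteq> Basis \<Longrightarrow> iter_pd bs g differentiable (at x)"
  by (simp add: test_functions_def smooth_def)

lemma iter_pd_zero_outside:
  assumes "closed K" "\<And>x. x \<notin> K \<Longrightarrow> g x = 0" "x \<notin> K"
  shows "iter_pd bs g x = 0"
  using assms(3)
proof (induction bs arbitrary: x)
  case (Cons b bs)
  have "(iter_pd bs g has_derivative (\<lambda>_. 0)) (at x)"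
    by (rule has_derivative_transform_within_open[where f = "\<lambda>_. 0" and s = "- K"])
       (use Cons assms(1) in auto)
  then show ?case by (simp flip: frechet_derivative_at)
qed (simp add: assms(2))

lemma test_function_derivative_L2:
  assumes D: "D \<in> lmeasurable" and g: "g \<in> test_functions D" and bs: "set bs \<subseteq> Basis"
  shows "iter_pd bs g \<in> L2 D"
proof -
  obtain K where K: "compact K" "\<And>x. x \<notin> K \<Longrightarrow> g x = 0"
    using g by (auto simp: test_functions_def)
  have cont: "continuous_on UNIV (iter_pd bs g)"
    using iter_pd_differentiable[OF g bs]
    by (simp add: continuous_on_eq_continuous_at differentiable_imp_continuous_within)
  have "bounded (iter_pd bs g ` K)"
    using K(1) cont by (intro compact_imp_bounded compact_continuous_image)
      (auto intro: continuous_on_subset)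
  then obtain B where B: "\<And>x. x \<in> K \<Longrightarrow> \<bar>iter_pd bs g x\<bar> \<le> B"
    by (auto simp: bounded_iff)
  show ?thesis
  proof (rule L2_bounded[OF D])
    show "iter_pd bs g \<in> borel_measurable (lebesgue_on D)"
      by (intro measurable_restrict_space1 measurable_completion)
         (simp add: borel_measurable_continuous_onI[OF cont])
    show "\<bar>iter_pd bs g x\<bar> \<le> \<bar>B\<bar>" for x
      using B[of x] iter_pd_zero_outside[OF compact_imp_closed[OF K(1)] K(2), where x = x and bs = bs]
      by (cases "x \<in> K") auto
  qed
qed

lemma is_weak_deriv_lincomb:
  assumes D: "D \<in> lmeasurable" and bs: "set bs \<subseteq> Basis" and v: "v \<in> L2 D" "w \<in> L2 D"
    and dv: "is_weak_deriv D bs v v'" "is_weak_deriv D bs w w'"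
  shows "is_weak_deriv D bs (\<lambda>x. a * v x + b * w x) (\<lambda>x. a * v' x + b * w' x)"
  unfolding is_weak_deriv_def
proof (intro conjI ballI)
  have v': "v' \<in> L2 D" "w' \<in> L2 D" using dv by (auto simp: is_weak_deriv_def)
  then show "(\<lambda>x. a * v' x + b * w' x) \<in> L2 D" by (rule L2_lincomb)
  fix g assume g: "g \<in> test_functions D"
  have g0: "g \<in> L2 D" using test_function_derivative_L2[OF D g, of "[]"] by simp
  have *: "ip D v (iter_pd bs g) = (-1) ^ length bs * ip D v' g"
    "ip D w (iter_pd bs g) = (-1) ^ length bs * ip D w' g"
    using dv g by (auto simp: is_weak_deriv_def)
  show "ip D (\<lambda>x. a * v x + b * w x) (iter_pd bs g)
      = (-1) ^ length bs * ip D (\<lambda>x. a * v' x + b * w' x) g"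
    unfolding ip_lincomb_left[OF v test_function_derivative_L2[OF D g bs]]
      ip_lincomb_left[OF v' g0] * by (simp add: algebra_simps)
qed

lemma weak_deriv_in_sobolev1:
  assumes "v \<in> sobolev D 1" "b \<in> Basis"
  shows "is_weak_deriv D [b] v (weak_deriv D [b] v)" "weak_deriv D [b] v \<in> L2 D"
proof -
  have "\<exists>w. is_weak_deriv D [b] v w"
    using assms by (auto simp: sobolev_def multi_indices_def)
  then show "is_weak_deriv D [b] v (weak_deriv D [b] v)"
    unfolding weak_deriv_def by (rule someI_ex)
  then show "weak_deriv D [b] v \<in> L2 D" by (simp add: is_weak_deriv_def)
qed

lemma sobolev_L2: "v \<in> sobolev D k \<Longrightarrow> v \<in> L2 D"
  by (simp add: sobolev_def)

lemma sobolev0_sobolev1: "v \<in> sobolev0 D \<Longrightarrow> v \<in> sobolev D 1"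
  by (simp add: sobolev0_def)

lemma sobolev_lincomb:
  assumes "D \<in> lmeasurable" "v \<in> sobolev D k" "w \<in> sobolev D k"
  shows "(\<lambda>x. a * v x + b * w x) \<in> sobolev D k"
  using assms is_weak_deriv_lincomb[OF assms(1)]
  unfolding sobolev_def multi_indices_def by (auto intro!: L2_lincomb) blast

lemma sobolev_zero:
  assumes "D \<in> lmeasurable" shows "(\<lambda>x. 0) \<in> sobolev D k"
  unfolding sobolev_def is_weak_deriv_def using L2_zero by (auto intro!: exI[of _ "\<lambda>x. 0"])

text \<open>
  Weak derivatives are determined only up to functions orthogonal to all test functions, so the
  Dirichlet form is bilinear as soon as no nonzero function has this property.
\<close>

definition test_functions_total :: "'a::euclidean_space set \<Rightarrow> bool" where
  "test_functions_total D \<longleftrightarrow>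
     (\<forall>v \<in> L2 D. (\<forall>g \<in> test_functions D. ip D v g = 0) \<longrightarrow> L2norm D v = 0)"

text \<open>
  A function \<open>v\<close> orthogonal to all test functions has the same weak derivatives as \<open>0\<close>. Hence the
  Sobolev norm of order \<open>0\<close>, which is computed from \<open>weak_deriv D []\<close>, takes the same value at
  \<open>v\<close> and at \<open>0\<close>. Its equivalence with the spectral norm forces this value to be \<open>0\<close>, and then
  \<open>v\<close> to vanish: the identification of the two scales at order \<open>0\<close> contains the fundamental lemma
  of the calculus of variations.
\<close>

lemma test_functions_total_if_dotH_is_sobolev_0:
  assumes onb: "complete_onb D \<phi>" and pos: "\<And>k. lam k > 0" and dotH: "dotH_is_sobolev D lam \<phi> 0"
  shows "test_functions_total D"
  unfolding test_functions_total_def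
proof (intro ballI impI)
  fix v assume v: "v \<in> L2 D" and orth: "\<forall>g\<in>test_functions D. ip D v g = 0"
  have nz: "lam k \<noteq> 0" for k using pos[of k] by simp
  have mem: "coeffs D \<phi> z \<in> dotH lam (real 0)"
    and norm: "dotH_norm lam (real 0) (coeffs D \<phi> z) = L2norm D z" if "z \<in> L2 D" for z
    using Parseval[OF onb that]
    by (auto simp: dotH_def dotH_norm_def nz sums_iff)
  obtain C where C: "C > 0"
    "\<And>z. z \<in> L2 D \<Longrightarrow> sobolev_norm D 0 z \<le> C * L2norm D z"
    "\<And>z. z \<in> L2 D \<Longrightarrow> L2norm D z \<le> C * sobolev_norm D 0 z"
    using dotH mem norm unfolding dotH_is_sobolev_def by metis
  have "is_weak_deriv D [] v = is_weak_deriv D [] (\<lambda>x. 0)"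
    using orth by (auto simp: is_weak_deriv_def fun_eq_iff)
  then have "sobolev_norm D 0 v = sobolev_norm D 0 (\<lambda>x. 0)"
    by (simp add: sobolev_norm_def multi_indices_def weak_deriv_def)
  also have "\<dots> \<le> 0" using C(2)[OF L2_zero] by (simp add: L2norm_def)
  finally have "C * sobolev_norm D 0 v \<le> 0" using C(1) by (simp add: mult_le_0_iff)
  then show "L2norm D v = 0" using C(3)[OF v] L2norm_nonneg[of D v] by linarith
qed

lemma grad_ip_lincomb_left:
  assumes D: "D \<in> lmeasurable" and total: "test_functions_total D"
    and v: "v \<in> sobolev D 1" "w \<in> sobolev D 1" and z: "z \<in> sobolev D 1"
  shows "grad_ip D (\<lambda>x. a * v x + b * w x) z = a * grad_ip D v z + b * grad_ip D w z"
proof -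
  let ?y = "\<lambda>x. a * v x + b * w x"
  have y: "?y \<in> sobolev D 1" by (rule sobolev_lincomb[OF D v])
  have "ip D (weak_deriv D [i] ?y) (weak_deriv D [i] z)
      = a * ip D (weak_deriv D [i] v) (weak_deriv D [i] z)
        + b * ip D (weak_deriv D [i] w) (weak_deriv D [i] z)" if i: "i \<in> Basis" for i
  proof -
    let ?y1 = "weak_deriv D [i] ?y" and ?z1 = "weak_deriv D [i] z"
    let ?y2 = "\<lambda>x. a * weak_deriv D [i] v x + b * weak_deriv D [i] w x"
    note d = weak_deriv_in_sobolev1[OF _ i]
    have "is_weak_deriv D [i] ?y ?y2"
      using i v d by (intro is_weak_deriv_lincomb[OF D]) (auto intro: sobolev_L2)
    with d(1)[OF y] have eq: "ip D ?y1 g = ip D ?y2 g" if "g \<in> test_functions D" for g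
      using that by (force simp: is_weak_deriv_def)
    have y12: "?y1 \<in> L2 D" "?y2 \<in> L2 D" using d y v by (auto intro: L2_lincomb)
    have "L2norm D (\<lambda>x. ?y1 x - ?y2 x) = 0"
      using total L2_diff[OF y12] eq test_function_derivative_L2[OF D, of _ "[]"]
      by (auto simp: test_functions_total_def ip_diff_left[OF y12])
    from L2norm_zero_ip[OF L2_diff[OF y12] this d(2)[OF z]]
    have "ip D ?y1 ?z1 = ip D ?y2 ?z1" by (simp add: ip_diff_left[OF y12 d(2)[OF z]])
    also have "\<dots> = a * ip D (weak_deriv D [i] v) ?z1 + b * ip D (weak_deriv D [i] w) ?z1"
      using v z by (intro ip_lincomb_left d)
    finally show ?thesis .
  qed
  then show ?thesis
    by (simp add: grad_ip_def sum.distrib sum_distrib_left)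
qed

lemma grad_ip_zero_left:
  assumes D: "D \<in> lmeasurable" and total: "test_functions_total D" and z: "z \<in> sobolev D 1"
  shows "grad_ip D (\<lambda>x. 0) z = 0"
  using grad_ip_lincomb_left[OF D total sobolev_zero[OF D] sobolev_zero[OF D] z, of 0 0] by simp

lemma grad_ip_sum_left:
  fixes c :: "nat \<Rightarrow> real"
  assumes D: "D \<in> lmeasurable" and total: "test_functions_total D"
    and e: "\<And>k. e k \<in> sobolev D 1" and z: "z \<in> sobolev D 1"
  shows "(\<lambda>x. \<Sum>k<n. c k * e k x) \<in> sobolev D 1 \<and>
         grad_ip D (\<lambda>x. \<Sum>k<n. c k * e k x) z = (\<Sum>k<n. c k * grad_ip D (e k) z)"
proof (induction n)
  case 0
  then show ?case using grad_ip_zero_left[OF D total z] sobolev_zero[OF D] by simp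
next
  case (Suc n)
  let ?s = "\<lambda>x. \<Sum>k<n. c k * e k x"
  have "(\<lambda>x. 1 * ?s x + c n * e n x) \<in> sobolev D 1"
    using Suc e by (intro sobolev_lincomb[OF D]) auto
  moreover have "grad_ip D (\<lambda>x. 1 * ?s x + c n * e n x) z
      = 1 * grad_ip D ?s z + c n * grad_ip D (e n) z"
    using Suc e by (intro grad_ip_lincomb_left[OF D total _ _ z]) auto
  ultimately show ?case using Suc by simp
qed

section \<open>The spectral scale\<close>

lemma dotH_norm_nonneg: 
  assumes "\<And>k. lam k > 0" "c \<in> dotH lam s"
  shows "0 \<le> dotH_norm lam s c"
  unfolding dotH_norm_def using assms by (auto simp: dotH_def intro!: suminf_nonneg)

lemma dotH_norm_sq: 
  assumes "c \<in> dotH lam s"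
  shows "(dotH_norm lam s c)\<^sup>2 = (\<Sum>k. lam k powr s * (c k)\<^sup>2)"
  unfolding dotH_norm_def using assms by (auto simp: dotH_def intro!: suminf_nonneg)

lemma dotH_partial_sum_le:
  assumes "c \<in> dotH lam s" "finite S"
  shows "(\<Sum>k\<in>S. lam k powr s * (c k)\<^sup>2) \<le> (dotH_norm lam s c)\<^sup>2"
  unfolding dotH_norm_sq[OF assms(1)] using assms by (intro sum_le_suminf) (auto simp: dotH_def)

lemma dotH_lincomb:
  assumes "c \<in> dotH lam s" "d \<in> dotH lam s"
  shows "(\<lambda>k. a * c k + b * d k) \<in> dotH lam s"
  unfolding dotH_def mem_Collect_eq
proof (rule summable_comparison_test')
  show "summable (\<lambda>k. 2 * a\<^sup>2 * (lam k powr s * (c k)\<^sup>2) + 2 * b\<^sup>2 * (lam k powr s * (d k)\<^sup>2))"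
    using assms by (intro summable_add summable_mult) (auto simp: dotH_def)
  fix k :: nat
  have "(a * c k + b * d k)\<^sup>2 \<le> 2 * a\<^sup>2 * (c k)\<^sup>2 + 2 * b\<^sup>2 * (d k)\<^sup>2"
    using sum_squares_bound[of "a * c k" "b * d k"] by (simp add: power2_sum power_mult_distrib)
  from mult_left_mono[OF this, of "lam k powr s"]
  show "norm (lam k powr s * (a * c k + b * d k)\<^sup>2)
      \<le> 2 * a\<^sup>2 * (lam k powr s * (c k)\<^sup>2) + 2 * b\<^sup>2 * (lam k powr s * (d k)\<^sup>2)"
    by (simp add: algebra_simps)
qed

lemma dotH_sum:
  fixes c :: "nat \<Rightarrow> nat \<Rightarrow> real"
  assumes "\<And>m. c m \<in> dotH lam s"
  shows "(\<lambda>k. \<Sum>m<n. t m * c m k) \<in> dotH lam s"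
proof (induction n)
  case 0 then show ?case by (simp add: dotH_def)
next
  case (Suc n)
  then show ?case using dotH_lincomb[OF Suc assms[of n], of 1 "t n"] by simp
qed

lemma dotH_finite_support:
  assumes "\<And>k. n \<le> k \<Longrightarrow> c k = 0"
  shows "c \<in> dotH lam s" "dotH_norm lam s c = sqrt (\<Sum>k<n. lam k powr s * (c k)\<^sup>2)"
proof -
  have "(\<lambda>k. lam k powr s * (c k)\<^sup>2) sums (\<Sum>k<n. lam k powr s * (c k)\<^sup>2)"
    by (rule sums_finite) (use assms in auto)
  then show "c \<in> dotH lam s" "dotH_norm lam s c = sqrt (\<Sum>k<n. lam k powr s * (c k)\<^sup>2)"
    by (auto simp: dotH_def dotH_norm_def sums_iff)
qed

section \<open>Gaussian moments of the noise\<close>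

text \<open>
  Jensen's inequality for the power function, multiplied by the total weight so that the weights
  need not be normalized.
\<close>

lemma sum_power_le_weighted:
  fixes b z :: "'k \<Rightarrow> real"
  assumes "finite S" "\<And>k. k \<in> S \<Longrightarrow> 0 \<le> b k" "\<And>k. k \<in> S \<Longrightarrow> 0 \<le> z k"
  shows "(\<Sum>k\<in>S. b k * z k) ^ Suc q \<le> (\<Sum>k\<in>S. b k) ^ q * (\<Sum>k\<in>S. b k * z k ^ Suc q)"
proof (cases "(\<Sum>k\<in>S. b k) = 0")
  case True
  then have "b k = 0" if "k \<in> S" for k
    using assms that by (simp add: sum_nonneg_eq_0_iff)
  then show ?thesis by simp
next
  case False
  let ?B = "\<Sum>k\<in>S. b k"
  have B: "?B > 0" using False assms by (simp add: sum_nonneg less_le)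
  have conv: "convex_on {0::real..} (\<lambda>x. x ^ Suc q)"
    using convex_power_odd[of "Suc q"] convex_on_subset[OF convex_power_even[of "Suc q"], of "{0..}"]
    by (cases "even (Suc q)") (auto simp del: power_Suc)
  have "(\<Sum>k\<in>S. (b k / ?B) *\<^sub>R z k) ^ Suc q \<le> (\<Sum>k\<in>S. (b k / ?B) * z k ^ Suc q)"
    using assms B False
    by (intro convex_on_sum[OF _ _ conv]) (auto simp flip: sum_divide_distrib)
  moreover have "(\<Sum>k\<in>S. (b k / ?B) *\<^sub>R z k) = (\<Sum>k\<in>S. b k * z k) / ?B"
    by (simp add: sum_divide_distrib)
  moreover have "(\<Sum>k\<in>S. (b k / ?B) * z k ^ Suc q) = (\<Sum>k\<in>S. b k * z k ^ Suc q) / ?B"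
    by (simp add: sum_divide_distrib)
  ultimately have le: "((\<Sum>k\<in>S. b k * z k) / ?B) ^ Suc q \<le> (\<Sum>k\<in>S. b k * z k ^ Suc q) / ?B"
    by (simp only:)
  have "(\<Sum>k\<in>S. b k * z k) ^ Suc q = ?B ^ Suc q * ((\<Sum>k\<in>S. b k * z k) / ?B) ^ Suc q"
    using False by (simp only: power_divide) simp
  also have "\<dots> \<le> ?B ^ Suc q * ((\<Sum>k\<in>S. b k * z k ^ Suc q) / ?B)"
    using B by (intro mult_left_mono le) simp
  also have "\<dots> = ?B ^ q * (\<Sum>k\<in>S. b k * z k ^ Suc q)" using False by simp
  finally show ?thesis .
qed

text \<open>
  The sum is a centred normal variable whose variance is the sum of the squared coefficients. The
  zero coefficients are dropped first, because a normal density has positive variance.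
\<close>

lemma (in prob_space) gaussian_sum_moment:
  fixes \<eta> :: "nat \<Rightarrow> 'a \<Rightarrow> real"
  assumes indep: "indep_vars (\<lambda>_. borel) \<eta> UNIV"
    and normal: "\<And>m. distributed M lborel (\<eta> m) std_normal_density"
  shows "has_bochner_integral M (\<lambda>\<omega>. (\<Sum>m<n. \<eta> m \<omega> * a m) ^ (2 * q))
           (fact (2 * q) / (2 ^ q * fact q) * (\<Sum>m<n. (a m)\<^sup>2) ^ q)"
proof -
  define J where "J = {m. m < n \<and> a m \<noteq> 0}"
  have J: "finite J" by (rule finite_subset[of _ "{..<n}"]) (auto simp: J_def)
  have S: "(\<Sum>m<n. \<eta> m \<omega> * a m) = (\<Sum>m\<in>J. a m * \<eta> m \<omega>)" for \<omega>
    unfolding J_def by (rule sum.mono_neutral_cong_right) auto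
  have Q: "(\<Sum>m<n. (a m)\<^sup>2) = (\<Sum>m\<in>J. (a m)\<^sup>2)"
    unfolding J_def by (rule sum.mono_neutral_cong_right) auto
  show ?thesis
  proof (cases "J = {}")
    case True
    have "has_bochner_integral M (\<lambda>\<omega>. (0::real) ^ (2 * q)) (0 ^ (2 * q))"
      by (simp add: has_bochner_integral_iff prob_space)
    then show ?thesis unfolding S Q True by (cases "q = 0") (auto simp: zero_power)
  next
    case False
    let ?s = "sqrt (\<Sum>m\<in>J. \<bar>a m\<bar>\<^sup>2)"
    have pos: "0 < (\<Sum>m\<in>J. (a m)\<^sup>2)"
    proof (rule sum_pos[OF J False])
      show "0 < (a m)\<^sup>2" if "m \<in> J" for m
        using that unfolding J_def by simp
    qed
    have "indep_vars (\<lambda>_. borel) (\<lambda>m \<omega>. a m * \<eta> m \<omega>) J"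
      using indep_vars_compose2[OF indep_vars_subset[OF indep subset_UNIV],
          of J "\<lambda>m x. a m * x" "\<lambda>_. borel"] by simp
    moreover have "distributed M lborel (\<lambda>\<omega>. a m * \<eta> m \<omega>) (normal_density 0 \<bar>a m\<bar>)"
      if "m \<in> J" for m
      using normal_density_affine[OF normal[of m], of "a m" 0] that by (simp add: J_def)
    ultimately have dist: "distributed M lborel (\<lambda>\<omega>. \<Sum>m\<in>J. a m * \<eta> m \<omega>) (normal_density 0 ?s)"
      using sum_indep_normal[OF J False, of "\<lambda>m \<omega>. a m * \<eta> m \<omega>" "\<lambda>m. \<bar>a m\<bar>" "\<lambda>_. 0"]
      by (simp add: J_def)
    have s2: "?s\<^sup>2 = (\<Sum>m\<in>J. (a m)\<^sup>2)" and spos: "?s > 0" using pos by auto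
    note mom = normal_moment_even[OF spos, of 0 q]
    have "integrable M (\<lambda>\<omega>. (\<Sum>m\<in>J. a m * \<eta> m \<omega>) ^ (2 * q))"
      using distributed_integrable[OF dist, of "\<lambda>x. x ^ (2 * q)"] mom
      by (simp add: has_bochner_integral_iff normal_density_nonneg)
    moreover have "(\<integral>\<omega>. (\<Sum>m\<in>J. a m * \<eta> m \<omega>) ^ (2 * q) \<partial>M)
        = fact (2 * q) / ((2 / ?s\<^sup>2) ^ q * fact q)"
      using distributed_integral[OF dist, of "\<lambda>x. x ^ (2 * q)"] mom
      by (simp add: has_bochner_integral_iff normal_density_nonneg)
    moreover have "fact (2 * q) / ((2 / ?s\<^sup>2) ^ q * fact q)
        = fact (2 * q) / (2 ^ q * fact q) * (\<Sum>m\<in>J. (a m)\<^sup>2) ^ q"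
      unfolding s2 using pos by (simp add: power_divide field_simps)
    ultimately show ?thesis unfolding S Q has_bochner_integral_iff by simp
  qed
qed

text \<open>
  The modes \<open>k\<close> are dependent, but each of them has a moment of order \<open>2 (q + 1)\<close> proportional to
  the power \<open>q + 1\<close> of its variance. Normalizing every mode by its variance and taking the
  weights times the variances as new weights, Jensen's inequality bounds the moment of the sum in
  terms of the total variance \<open>B\<close> only, uniformly in \<open>K\<close> and \<open>n\<close>.
\<close>

lemma (in prob_space) weighted_gaussian_sum_moment:
  fixes a :: "nat \<Rightarrow> nat \<Rightarrow> real"
  assumes indep: "indep_vars (\<lambda>_. borel) \<eta> UNIV"
    and normal: "\<And>m. distributed M lborel (\<eta> m) std_normal_density"
    and mu: "\<And>k. 0 \<le> \<mu> k"
    and B: "(\<Sum>k<K. \<mu> k * (\<Sum>m<n. (a m k)\<^sup>2)) \<le> B"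
  shows "(\<integral>\<^sup>+\<omega>. ennreal ((\<Sum>k<K. \<mu> k * (\<Sum>m<n. \<eta> m \<omega> * a m k)\<^sup>2) ^ Suc q) \<partial>M)
      \<le> ennreal (B ^ Suc q * (fact (2 * Suc q) / (2 ^ Suc q * fact (Suc q))))"
proof -
  define G :: real where "G = fact (2 * Suc q) / (2 ^ Suc q * fact (Suc q))"
  define v where "v k = (\<Sum>m<n. (a m k)\<^sup>2)" for k
  define S where "S k \<omega> = (\<Sum>m<n. \<eta> m \<omega> * a m k)" for k \<omega>
  define b where "b k = \<mu> k * v k" for k
  have v: "0 \<le> v k" for k by (simp add: v_def sum_nonneg)
  have b: "0 \<le> b k" for k using mu v by (simp add: b_def)
  have G: "0 \<le> G" by (simp add: G_def)
  have mom: "has_bochner_integral M (\<lambda>\<omega>. S k \<omega> ^ (2 * Suc q)) (G * v k ^ Suc q)" for k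
    using gaussian_sum_moment[OF indep normal, where n = n and a = "\<lambda>m. a m k" and q = "Suc q"]
    unfolding S_def v_def G_def .
  have S0: "S k \<omega> = 0" if "v k = 0" for k \<omega>
  proof -
    have "a m k = 0" if "m < n" for m
      using \<open>v k = 0\<close> that by (simp add: v_def sum_nonneg_eq_0_iff)
    then show ?thesis by (simp add: S_def)
  qed
  \<comment> \<open>A mode of variance \<open>0\<close> vanishes identically, so dividing by the variance is harmless.\<close>
  have mS: "\<mu> k * (S k \<omega>)\<^sup>2 = b k * ((S k \<omega>)\<^sup>2 / v k)" for k \<omega>
    using S0[of k \<omega>] by (cases "v k = 0") (auto simp: b_def)
  have int: "has_bochner_integral M (\<lambda>\<omega>. ((S k \<omega>)\<^sup>2 / v k) ^ Suc q) (if v k = 0 then 0 else G)" for k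
  proof (cases "v k = 0")
    case True then show ?thesis using has_bochner_integral_zero[of M] by simp
  next
    case False
    have "has_bochner_integral M (\<lambda>\<omega>. S k \<omega> ^ (2 * Suc q) / v k ^ Suc q) (G * v k ^ Suc q / v k ^ Suc q)"
      by (intro has_bochner_integral_divide mom)
    then show ?thesis using False by (simp add: power_divide power_mult del: power_Suc mult_Suc_right)
  qed
  let ?R = "\<lambda>\<omega>. (\<Sum>k<K. b k) ^ q * (\<Sum>k<K. b k * ((S k \<omega>)\<^sup>2 / v k) ^ Suc q)"
  have R: "has_bochner_integral M ?R ((\<Sum>k<K. b k) ^ q * (\<Sum>k<K. b k * (if v k = 0 then 0 else G)))"
    by (intro has_bochner_integral_mult_right has_bochner_integral_sum int)
  have R0: "0 \<le> ?R \<omega>" for \<omega>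
    using b v by (intro mult_nonneg_nonneg zero_le_power sum_nonneg) auto
  have "(\<integral>\<^sup>+\<omega>. ennreal ((\<Sum>k<K. \<mu> k * (S k \<omega>)\<^sup>2) ^ Suc q) \<partial>M) \<le> (\<integral>\<^sup>+\<omega>. ennreal (?R \<omega>) \<partial>M)"
    unfolding mS using b v
    by (intro nn_integral_mono ennreal_leI sum_power_le_weighted) auto
  also have "\<dots> = ennreal (\<integral>\<omega>. ?R \<omega> \<partial>M)"
    by (rule nn_integral_eq_integral[OF integrable.intros[OF R] AE_I2[OF R0]])
  also have "(\<integral>\<omega>. ?R \<omega> \<partial>M) = (\<Sum>k<K. b k) ^ q * (\<Sum>k<K. b k * (if v k = 0 then 0 else G))"
    by (rule has_bochner_integral_integral_eq[OF R])
  also have "\<dots> \<le> ennreal (B ^ Suc q * G)"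
  proof (rule ennreal_leI)
    have "(\<Sum>k<K. b k * (if v k = 0 then 0 else G)) \<le> (\<Sum>k<K. b k) * G"
      using b G unfolding sum_distrib_right by (intro sum_mono mult_left_mono) auto
    then have "(\<Sum>k<K. b k) ^ q * (\<Sum>k<K. b k * (if v k = 0 then 0 else G))
        \<le> (\<Sum>k<K. b k) ^ q * ((\<Sum>k<K. b k) * G)"
      using b by (intro mult_left_mono zero_le_power sum_nonneg) auto
    also have "\<dots> = (\<Sum>k<K. b k) ^ Suc q * G" by simp
    also have "\<dots> \<le> B ^ Suc q * G"
      using B b G unfolding b_def v_def
      by (intro mult_right_mono power_mono) (auto simp: sum_nonneg)
    finally show "(\<Sum>k<K. b k) ^ q * (\<Sum>k<K. b k * (if v k = 0 then 0 else G)) \<le> B ^ Suc q * G" .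
  qed
  finally show ?thesis unfolding S_def G_def .
qed

text \<open>
  Fatou's lemma along an almost everywhere convergent sequence.
\<close>

lemma nn_integral_AE_limit_le:
  fixes f :: "nat \<Rightarrow> 'w \<Rightarrow> real"
  assumes meas: "\<And>n. f n \<in> borel_measurable M"
    and lim: "AE \<omega> in M. (\<lambda>n. f n \<omega>) \<longlonglongrightarrow> g \<omega>"
    and le: "\<And>n. (\<integral>\<^sup>+\<omega>. ennreal (f n \<omega>) \<partial>M) \<le> C"
  shows "(\<integral>\<^sup>+\<omega>. ennreal (g \<omega>) \<partial>M) \<le> C"
proof -
  have "(\<integral>\<^sup>+\<omega>. ennreal (g \<omega>) \<partial>M) = (\<integral>\<^sup>+\<omega>. liminf (\<lambda>n. ennreal (f n \<omega>)) \<partial>M)"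
  proof (rule nn_integral_cong_AE)
    show "AE \<omega> in M. ennreal (g \<omega>) = liminf (\<lambda>n. ennreal (f n \<omega>))"
      using lim by eventually_elim (auto intro!: lim_imp_Liminf[symmetric] tendsto_ennrealI)
  qed
  also have "\<dots> \<le> liminf (\<lambda>n. \<integral>\<^sup>+\<omega>. ennreal (f n \<omega>) \<partial>M)"
    using meas by (intro nn_integral_liminf) auto
  also have "\<dots> \<le> C" using le by (intro Liminf_le) auto
  finally show ?thesis .
qed

lemma noise_norm_measurable:
  assumes "noise M D lam \<phi> \<sigma> \<psi> \<eta> s W"
  shows "(\<lambda>\<omega>. dotH_norm lam s (W \<omega>)) \<in> borel_measurable M"
proof -
  have [measurable]: "(\<lambda>\<omega>. W \<omega> k) \<in> borel_measurable M" for k using assms by (simp add: noise_def)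
  show ?thesis unfolding dotH_norm_def by measurable
qed

text \<open>
  The squared Hilbert-Schmidt norm of \<open>A\<^sup>s\<^sup>/\<^sup>2\<close> is the double series of the weighted squares of
  the coefficients of \<open>Q\<^sup>1\<^sup>/\<^sup>2 \<psi>\<^sub>m\<close>, that is, the total variance of the noise in the spectral space of
  order \<open>s\<close>. It bounds all finite sections of this double series.
\<close>

lemma HS_finite_bound:
  fixes lam :: "nat \<Rightarrow> real"
  assumes pos: "\<And>k. lam k > 0" and HS: "HS_finite D lam \<phi> \<sigma> \<psi> (s / 2)"
  shows "coeffs D \<phi> (sqrtQ \<sigma> \<psi> m) \<in> dotH lam s"
    and "\<exists>B. \<forall>n K. (\<Sum>k<K. lam k powr s * (\<Sum>m<n. (coeffs D \<phi> (sqrtQ \<sigma> \<psi> m) k)\<^sup>2)) \<le> B"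
proof -
  let ?a = "\<lambda>m. coeffs D \<phi> (sqrtQ \<sigma> \<psi> m)"
  let ?T = "\<lambda>m. (dotH_norm lam 0 (A_pow lam (s / 2) (?a m)))\<^sup>2"
  have nz: "lam k \<noteq> 0" for k using pos[of k] by simp
  have eq: "lam k powr 0 * (A_pow lam (s / 2) c k)\<^sup>2 = lam k powr s * (c k)\<^sup>2" for k c
    by (simp add: A_pow_def power_mult_distrib nz) (simp add: power2_eq_square flip: powr_add)
  have mem: "?a m \<in> dotH lam s" for m
  proof -
    have "A_pow lam (s / 2) (?a m) \<in> dotH lam 0" using HS by (simp add: HS_finite_def)
    then show ?thesis unfolding dotH_def mem_Collect_eq eq .
  qed
  then show "?a m \<in> dotH lam s" .
  have T: "?T m = (dotH_norm lam s (?a m))\<^sup>2" for m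
    unfolding dotH_norm_def eq ..
  have "(\<Sum>k<K. lam k powr s * (\<Sum>m<n. (?a m k)\<^sup>2)) \<le> (\<Sum>m. ?T m)" for n K
  proof -
    have "(\<Sum>k<K. lam k powr s * (\<Sum>m<n. (?a m k)\<^sup>2)) = (\<Sum>m<n. \<Sum>k<K. lam k powr s * (?a m k)\<^sup>2)"
      by (subst sum.swap) (simp add: sum_distrib_left)
    also have "\<dots> \<le> (\<Sum>m<n. ?T m)"
      unfolding T by (intro sum_mono dotH_partial_sum_le mem) auto
    also have "\<dots> \<le> (\<Sum>m. ?T m)"
      using HS by (intro sum_le_suminf) (auto simp: HS_finite_def)
    finally show ?thesis .
  qed
  then show "\<exists>B. \<forall>n K. (\<Sum>k<K. lam k powr s * (\<Sum>m<n. (?a m k)\<^sup>2)) \<le> B" by blast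
qed

text \<open>
  The moments are bounded first for the partial sums of the noise and finitely many modes. Mean
  square convergence gives an almost surely convergent subsequence of the partial sums, so that
  the bound is inherited by finitely many modes of \<open>W\<close>; increasing the number of modes, it is
  inherited by the whole norm. Both limits are instances of Fatou's lemma.
\<close>

lemma noise_moments_finite:
  assumes prob: "prob_space M" and pos: "\<And>k. lam k > 0" and normals: "iid_std_normal M \<eta>"
    and HS: "HS_finite D lam \<phi> \<sigma> \<psi> (s / 2)" and W: "noise M D lam \<phi> \<sigma> \<psi> \<eta> s W"
  shows "integrable M (\<lambda>\<omega>. (dotH_norm lam s (W \<omega>)) ^ (2 * Suc q))"
proof -
  interpret prob_space M by fact
  let ?a = "\<lambda>m. coeffs D \<phi> (sqrtQ \<sigma> \<psi> m)"
  note mem = HS_finite_bound(1)[OF pos HS]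
  obtain B where B: "\<And>n K. (\<Sum>k<K. lam k powr s * (\<Sum>m<n. (?a m k)\<^sup>2)) \<le> B"
    using HS_finite_bound(2)[OF pos HS] by blast
  have [measurable]: "\<eta> m \<in> borel_measurable M" for m
    using normals distributed_measurable[of M lborel "\<eta> m"] by (auto simp: iid_std_normal_def)
  have [measurable]: "(\<lambda>\<omega>. W \<omega> k) \<in> borel_measurable M" for k using W by (simp add: noise_def)
  define Z where "Z n \<omega> k = (\<Sum>m<n. \<eta> m \<omega> * ?a m k)" for n \<omega> k
  have [measurable]: "(\<lambda>\<omega>. Z n \<omega> k) \<in> borel_measurable M" for n k unfolding Z_def by measurable
  define E where "E n \<omega> = (dotH_norm lam s (\<lambda>k. Z n \<omega> k - W \<omega> k))\<^sup>2" for n \<omega>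
  have [measurable]: "E n \<in> borel_measurable M" for n unfolding E_def dotH_norm_def by measurable
  have E0: "0 \<le> E n \<omega>" for n \<omega> by (simp add: E_def)
  have limE: "(\<lambda>n. \<integral>\<^sup>+\<omega>. ennreal (E n \<omega>) \<partial>M) \<longlonglongrightarrow> 0"
    using W unfolding noise_def E_def Z_def by simp
  have Wmem: "AE \<omega> in M. W \<omega> \<in> dotH lam s" using W by (simp add: noise_def)
  \<comment> \<open>The first few expectations may be infinite; the sequence is shifted beyond them.\<close>
  have "eventually (\<lambda>n. (\<integral>\<^sup>+\<omega>. ennreal (E n \<omega>) \<partial>M) < 1) sequentially"
    using limE by (rule order_tendstoD) simp
  then obtain n0 where n0: "\<And>n. n0 \<le> n \<Longrightarrow> (\<integral>\<^sup>+\<omega>. ennreal (E n \<omega>) \<partial>M) < 1"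
    by (auto simp: eventually_sequentially)
  have intE: "integrable M (E (n + n0))" for n
    using n0[of "n + n0"] E0 
    by (intro integrableI_nonneg) (auto intro: less_trans[OF _ ennreal_one_less_top])
  have "(\<lambda>n. \<integral>\<omega>. norm (E (n + n0) \<omega>) \<partial>M) \<longlonglongrightarrow> 0"
  proof -
    have "(\<lambda>n. enn2real (\<integral>\<^sup>+\<omega>. ennreal (E (n + n0) \<omega>) \<partial>M)) \<longlonglongrightarrow> 0"
      using LIMSEQ_ignore_initial_segment[OF limE, of n0] by (intro tendsto_enn2real) auto
    then show ?thesis using E0 by (simp add: integral_eq_nn_integral)
  qed
  from tendsto_L1_AE_subseq[OF intE this] obtain r :: "nat \<Rightarrow> nat"
    where r: "AE \<omega> in M. (\<lambda>n. E (r n + n0) \<omega>) \<longlonglongrightarrow> 0" by auto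
  have limZ: "AE \<omega> in M. \<forall>k. (\<lambda>n. Z (r n + n0) \<omega> k) \<longlonglongrightarrow> W \<omega> k"
    using r Wmem
  proof eventually_elim
    case (elim \<omega>)
    show ?case
    proof
      fix k
      have "lam k powr s * (Z n \<omega> k - W \<omega> k)\<^sup>2 \<le> E n \<omega>" for n
      proof -
        have "(\<lambda>k. Z n \<omega> k) \<in> dotH lam s" unfolding Z_def by (intro dotH_sum mem)
        then have "(\<lambda>k. 1 * Z n \<omega> k + (-1) * W \<omega> k) \<in> dotH lam s"
          using elim by (intro dotH_lincomb) auto
        then have "(\<lambda>k. Z n \<omega> k - W \<omega> k) \<in> dotH lam s" by simp
        from dotH_partial_sum_le[OF this, of "{k}"] show ?thesis by (simp add: E_def)
      qed
      then have le: "norm ((Z n \<omega> k - W \<omega> k)\<^sup>2) \<le> E n \<omega> / lam k powr s" for n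
        using pos[of k] by (simp add: field_simps)
      have "(\<lambda>n. E (r n + n0) \<omega> / lam k powr s) \<longlonglongrightarrow> 0"
        by (rule tendsto_divide_zero[OF elim(1)])
      then have "(\<lambda>n. (Z (r n + n0) \<omega> k - W \<omega> k)\<^sup>2) \<longlonglongrightarrow> 0"
        by (rule Lim_null_comparison[OF always_eventually[OF allI[OF le]]])
      then have "(\<lambda>n. Z (r n + n0) \<omega> k - W \<omega> k) \<longlonglongrightarrow> 0"
        by (rule iffD1[OF power_tendsto_0_iff, rotated]) simp
      then show "(\<lambda>n. Z (r n + n0) \<omega> k) \<longlonglongrightarrow> W \<omega> k" by (simp add: LIM_zero_iff)
    qed
  qed
  define C where "C = ennreal (B ^ Suc q * (fact (2 * Suc q) / (2 ^ Suc q * fact (Suc q))))"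
  have "(\<integral>\<^sup>+\<omega>. ennreal ((\<Sum>k<K. lam k powr s * (W \<omega> k)\<^sup>2) ^ Suc q) \<partial>M) \<le> C" for K
  proof (rule nn_integral_AE_limit_le)
    show "AE \<omega> in M. (\<lambda>n. (\<Sum>k<K. lam k powr s * (Z (r n + n0) \<omega> k)\<^sup>2) ^ Suc q)
        \<longlonglongrightarrow> (\<Sum>k<K. lam k powr s * (W \<omega> k)\<^sup>2) ^ Suc q"
      using limZ by eventually_elim (intro tendsto_intros, auto)
    show "(\<integral>\<^sup>+\<omega>. ennreal ((\<Sum>k<K. lam k powr s * (Z (r n + n0) \<omega> k)\<^sup>2) ^ Suc q) \<partial>M) \<le> C" for n
      unfolding C_def Z_def using normals B
      by (intro weighted_gaussian_sum_moment) (auto simp: iid_std_normal_def)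
  qed measurable
  then have fin: "(\<integral>\<^sup>+\<omega>. ennreal ((dotH_norm lam s (W \<omega>)) ^ (2 * Suc q)) \<partial>M) \<le> C"
  proof (rule nn_integral_AE_limit_le[rotated 2])
    show "AE \<omega> in M. (\<lambda>K. (\<Sum>k<K. lam k powr s * (W \<omega> k)\<^sup>2) ^ Suc q)
        \<longlonglongrightarrow> (dotH_norm lam s (W \<omega>)) ^ (2 * Suc q)"
      using Wmem
    proof eventually_elim
      case (elim \<omega>)
      then have "(\<lambda>K. \<Sum>k<K. lam k powr s * (W \<omega> k)\<^sup>2) \<longlonglongrightarrow> (dotH_norm lam s (W \<omega>))\<^sup>2"
        unfolding dotH_norm_sq[OF elim] by (intro summable_LIMSEQ) (simp add: dotH_def)
      then show ?case unfolding power_mult by (rule tendsto_power)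
    qed
  qed measurable
  have [measurable]: "(\<lambda>\<omega>. dotH_norm lam s (W \<omega>)) \<in> borel_measurable M"
    by (rule noise_norm_measurable[OF W])
  show ?thesis
  proof (rule integrableI_nonneg)
    show "AE \<omega> in M. 0 \<le> dotH_norm lam s (W \<omega>) ^ (2 * Suc q)"
      by (simp add: power_mult del: mult_Suc_right power_Suc)
    show "(\<integral>\<^sup>+\<omega>. ennreal ((dotH_norm lam s (W \<omega>)) ^ (2 * Suc q)) \<partial>M) < \<infinity>"
      using fin by (rule le_less_trans) (simp add: C_def)
  qed measurable
qed

section \<open>The error for a fixed noise sample\<close>

lemma L2_set_coeffs_le:
  assumes "complete_onb D e" "v \<in> L2 D"
  shows "L2_set (coeffs D e v) {..<n} \<le> L2norm D v"
  unfolding L2_set_def using Bessel[OF assms] by (intro real_le_lsqrt) auto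

text \<open>
  Euclidean norms of finite sections are compared with spectral norms through pointwise bounds of
  the multipliers.
\<close>

lemma L2_set_le_dotH_norm:
  assumes "finite S" "\<And>k. lam k > 0" "c \<in> dotH lam s" "0 \<le> t"
    and "\<And>k. k \<in> S \<Longrightarrow> \<bar>d k\<bar> \<le> t * (lam k powr (s / 2) * \<bar>c k\<bar>)"
  shows "L2_set d S \<le> t * dotH_norm lam s c"
proof -
  have sq: "(lam k powr (s / 2) * \<bar>c k\<bar>)\<^sup>2 = lam k powr s * (c k)\<^sup>2" for k
    by (simp add: power_mult_distrib) (simp add: power2_eq_square flip: powr_add)
  have "L2_set d S = L2_set (\<lambda>k. \<bar>d k\<bar>) S" by (simp add: L2_set_def)
  also have "\<dots> \<le> L2_set (\<lambda>k. t * (lam k powr (s / 2) * \<bar>c k\<bar>)) S"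
    using assms(5) by (intro L2_set_mono) auto
  also have "\<dots> = t * L2_set (\<lambda>k. lam k powr (s / 2) * \<bar>c k\<bar>) S"
    using assms(4) by (rule L2_set_right_distrib[symmetric])
  also have "\<dots> \<le> t * dotH_norm lam s c"
  proof (rule mult_left_mono)
    show "L2_set (\<lambda>k. lam k powr (s / 2) * \<bar>c k\<bar>) S \<le> dotH_norm lam s c"
      unfolding L2_set_def sq
      by (rule real_le_lsqrt[OF dotH_norm_nonneg[OF assms(2,3)] dotH_partial_sum_le[OF assms(3,1)]])
  qed (rule assms(4))
  finally show ?thesis .
qed

text \<open>
  The deterministic setting: eigenfunction expansion, Poincare inequality, and agreement of the two
  scales at order \<open>0\<close>, by which the Dirichlet form is bilinear.
\<close>

locale dirichlet_problem =
  fixes D :: "'a::euclidean_space set" and lam :: "nat \<Rightarrow> real" and \<phi> :: "nat \<Rightarrow> 'a \<Rightarrow> real"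
    and \<gamma> :: real
  assumes domain: "D \<in> lmeasurable"
    and eigensystem: "dirichlet_eigensystem D lam \<phi>"
    and dotH0: "dotH_is_sobolev D lam \<phi> 0"
    and poincare: "poincare_constant D \<gamma>"
begin

lemma onb: "complete_onb D \<phi>" using eigensystem by (simp add: dirichlet_eigensystem_def)

lemma lam_pos: "0 < lam k" using eigensystem by (simp add: dirichlet_eigensystem_def)

lemma lam_mono: "j \<le> k \<Longrightarrow> lam j \<le> lam k"
  using eigensystem by (simp add: dirichlet_eigensystem_def mono_def)

lemma \<phi>_sobolev0: "\<phi> k \<in> sobolev0 D"
  using eigensystem by (simp add: dirichlet_eigensystem_def dirichlet_laplacian_def)

lemma \<phi>_L2: "\<phi> k \<in> L2 D" by (rule onb_L2[OF onb])

lemma grad_ip_\<phi>: "z \<in> sobolev0 D \<Longrightarrow> grad_ip D (\<phi> k) z = lam k * ip D (\<phi> k) z"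
  using eigensystem ip_cmult_left[OF \<phi>_L2 sobolev_L2[OF sobolev0_sobolev1], of z "lam k" k]
  by (simp add: dirichlet_eigensystem_def dirichlet_laplacian_def)

lemma \<gamma>_pos: "0 < \<gamma>" using poincare by (simp add: poincare_constant_def)

text \<open>
  An eigenvalue is the Dirichlet form of a normalized eigenfunction. By this bound, \<open>A\<^sup>-\<^sup>1 f\<close> is
  a contraction if the Lipschitz constant of \<open>f\<close> is below \<open>\<gamma>\<close>.
\<close>

lemma \<gamma>_le_lam: "\<gamma> \<le> lam k"
proof -
  have "\<gamma> * (L2norm D (\<phi> k))\<^sup>2 \<le> grad_ip D (\<phi> k) (\<phi> k)"
    using poincare \<phi>_sobolev0 by (simp add: poincare_constant_def)
  then show ?thesis by (simp add: grad_ip_\<phi>[OF \<phi>_sobolev0] L2norm_sq onb_ip[OF onb])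
qed

lemma test_functions_total: "test_functions_total D"
  by (rule test_functions_total_if_dotH_is_sobolev_0[OF onb lam_pos dotH0])

lemma spectral_proj_L2: "spectral_proj \<phi> n c \<in> L2 D"
  unfolding spectral_proj_def by (intro L2_sum \<phi>_L2)

lemma ip_spectral_proj:
  "z \<in> L2 D \<Longrightarrow> ip D (spectral_proj \<phi> n c) z = (\<Sum>k<n. c k * ip D (\<phi> k) z)"
  unfolding spectral_proj_def by (intro ip_sum_left \<phi>_L2)

lemma coeffs_spectral_proj: "coeffs D \<phi> (spectral_proj \<phi> n c) k = (if k < n then c k else 0)"
  unfolding spectral_proj_def by (rule coeffs_sum[OF onb])

lemma grad_ip_spectral_proj:
  assumes z: "z \<in> sobolev0 D"
  shows "grad_ip D (spectral_proj \<phi> n c) z = ip D (spectral_proj \<phi> n (\<lambda>k. lam k * c k)) z"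
proof -
  have "grad_ip D (spectral_proj \<phi> n c) z = (\<Sum>k<n. c k * grad_ip D (\<phi> k) z)"
    using grad_ip_sum_left[OF domain test_functions_total sobolev0_sobolev1[OF \<phi>_sobolev0]
        sobolev0_sobolev1[OF z], where c = c and n = n]
    by (simp add: spectral_proj_def)
  then show ?thesis
    using z by (simp add: grad_ip_\<phi> ip_spectral_proj[OF sobolev_L2[OF sobolev0_sobolev1[OF z]]] mult_ac)
qed

text \<open>
  A finite sum of eigenfunctions lies in every spectral space, hence in \<open>H\<^sup>2\<close> with zero boundary
  values. Its \<open>H\<^sup>2\<close> norm is controlled by the norm of its image under \<open>A\<close>, with a constant that
  does not depend on the number of terms.
\<close>

lemma spectral_proj_H2:
  assumes dotH2: "dotH_is_sobolev D lam \<phi> 2"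
  shows "spectral_proj \<phi> n c \<in> sobolev0 D \<inter> sobolev D 2"
    and "\<exists>C>0. \<forall>n c. sobolev_norm D 2 (spectral_proj \<phi> n c) \<le> C * L2_set (\<lambda>k. lam k * c k) {..<n}"
proof -
  have mem: "coeffs D \<phi> (spectral_proj \<phi> n c) \<in> dotH lam (real 2)" for n c
    by (rule dotH_finite_support(1)[of n]) (simp add: coeffs_spectral_proj)
  have iff: "\<forall>v\<in>L2 D. coeffs D \<phi> v \<in> dotH lam (real 2) \<longleftrightarrow>
        v \<in> sobolev D 2 \<and> (\<forall>j. 2 * j < 2 \<longrightarrow> (neg_laplace D ^^ j) v \<in> sobolev0 D)"
    using dotH2 by (simp add: dotH_is_sobolev_def)
  have "spectral_proj \<phi> n c \<in> sobolev D 2 \<and>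
      (\<forall>j. 2 * j < 2 \<longrightarrow> (neg_laplace D ^^ j) (spectral_proj \<phi> n c) \<in> sobolev0 D)"
    using bspec[OF iff spectral_proj_L2] mem by blast
  then show "spectral_proj \<phi> n c \<in> sobolev0 D \<inter> sobolev D 2"
    by (auto dest: spec[of _ 0])
  have norm: "dotH_norm lam (real 2) (coeffs D \<phi> (spectral_proj \<phi> n c))
      = L2_set (\<lambda>k. lam k * c k) {..<n}" for n c
  proof -
    have "dotH_norm lam (real 2) (coeffs D \<phi> (spectral_proj \<phi> n c))
        = sqrt (\<Sum>k<n. lam k powr real 2 * (coeffs D \<phi> (spectral_proj \<phi> n c) k)\<^sup>2)"
      by (rule dotH_finite_support(2)) (simp add: coeffs_spectral_proj)
    also have "\<dots> = sqrt (\<Sum>k<n. (lam k * c k)\<^sup>2)"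
      using powr_realpow[OF lam_pos, of _ 2]
      by (intro arg_cong[of _ _ sqrt] sum.cong)
         (auto simp: coeffs_spectral_proj power_mult_distrib)
    finally show ?thesis by (simp add: L2_set_def)
  qed
  obtain C where C: "C > 0" "\<And>v. v \<in> L2 D \<Longrightarrow> coeffs D \<phi> v \<in> dotH lam (real 2) \<Longrightarrow>
      sobolev_norm D 2 v \<le> C * dotH_norm lam (real 2) (coeffs D \<phi> v)"
    using dotH2 unfolding dotH_is_sobolev_def by blast
  then show "\<exists>C>0. \<forall>n c. sobolev_norm D 2 (spectral_proj \<phi> n c)
      \<le> C * L2_set (\<lambda>k. lam k * c k) {..<n}"
    using C(2)[OF spectral_proj_L2 mem] unfolding norm by blast
qed

text \<open>
  Truncation of the noise: on the modes from \<open>N\<close> on, the factor \<open>1/\<lambda>\<^sub>k\<close> is the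
  multiplier of the norm of order \<open>\<beta> - 2\<close> times \<open>\<lambda>\<^sub>k\<close> to the power \<open>-\<beta>/2\<close>, and the latter decreases in \<open>k\<close>.
\<close>

lemma L2_set_A_inverse_le:
  assumes "c \<in> dotH lam (\<beta> - 2)" "0 \<le> \<beta>" "finite S"
  shows "L2_set (\<lambda>k. if k < N then 0 else c k / lam k) S
      \<le> lam N powr (- \<beta> / 2) * dotH_norm lam (\<beta> - 2) c"
proof (rule L2_set_le_dotH_norm[OF assms(3) lam_pos assms(1)])
  fix k
  have "\<bar>c k\<bar> / lam k \<le> lam N powr (- \<beta> / 2) * (lam k powr ((\<beta> - 2) / 2) * \<bar>c k\<bar>)"
    if "N \<le> k"
  proof -
    have "1 / lam k = lam k powr (- \<beta> / 2 + (\<beta> - 2) / 2)"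
      using lam_pos[of k] by (simp add: field_simps powr_minus_divide flip: powr_minus_divide)
    also have "\<dots> = lam k powr (- \<beta> / 2) * lam k powr ((\<beta> - 2) / 2)" by (rule powr_add)
    also have "\<dots> \<le> lam N powr (- \<beta> / 2) * lam k powr ((\<beta> - 2) / 2)"
      using lam_mono[OF that] lam_pos[of N] assms(2)
      by (intro mult_right_mono powr_mono2') auto
    finally have "1 / lam k * \<bar>c k\<bar> \<le> lam N powr (- \<beta> / 2) * lam k powr ((\<beta> - 2) / 2) * \<bar>c k\<bar>"
      by (intro mult_right_mono) auto
    then show ?thesis by simp
  qed
  then show "\<bar>if k < N then 0 else c k / lam k\<bar>
      \<le> lam N powr (- \<beta> / 2) * (lam k powr ((\<beta> - 2) / 2) * \<bar>c k\<bar>)"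
    using lam_pos[of k] by auto
qed simp

text \<open>
  An inverse estimate: the projected noise is square integrable, at the price of the power
  \<open>(2-\<beta>)/2\<close> of the largest eigenvalue that occurs. As sequences start at \<open>0\<close>, this eigenvalue
  has the index \<open>N - 1\<close>.
\<close>

lemma L2_set_noise_le:
  assumes "c \<in> dotH lam (\<beta> - 2)" "\<beta> \<le> 2" "1 \<le> N" "finite S"
  shows "L2_set (\<lambda>k. if k < N then c k else 0) S
      \<le> lam (N - 1) powr ((2 - \<beta>) / 2) * dotH_norm lam (\<beta> - 2) c"
proof (rule L2_set_le_dotH_norm[OF assms(4) lam_pos assms(1)])
  fix k
  have "\<bar>c k\<bar> \<le> lam (N - 1) powr ((2 - \<beta>) / 2) * (lam k powr ((\<beta> - 2) / 2) * \<bar>c k\<bar>)"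
    if "k < N"
  proof -
    have "1 = lam k powr ((2 - \<beta>) / 2) * lam k powr ((\<beta> - 2) / 2)"
      using lam_pos[of k] by (simp add: field_simps flip: powr_add)
    also have "\<dots> \<le> lam (N - 1) powr ((2 - \<beta>) / 2) * lam k powr ((\<beta> - 2) / 2)"
      using lam_mono[of k "N - 1"] that lam_pos[of k] assms(2)
      by (intro mult_right_mono powr_mono2) auto
    finally have "1 * \<bar>c k\<bar> \<le> lam (N - 1) powr ((2 - \<beta>) / 2) * lam k powr ((\<beta> - 2) / 2) * \<bar>c k\<bar>"
      by (intro mult_right_mono) auto
    then show ?thesis by simp
  qed
  then show "\<bar>if k < N then c k else 0\<bar>
      \<le> lam (N - 1) powr ((2 - \<beta>) / 2) * (lam k powr ((\<beta> - 2) / 2) * \<bar>c k\<bar>)"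
    using lam_pos[of k] by auto
qed simp

lemma L2_set_divide_lam_le:
  assumes "g \<in> L2 D"
  shows "L2_set (\<lambda>k. coeffs D \<phi> g k / lam k) {..<m} \<le> L2norm D g / \<gamma>"
proof -
  have "L2_set (\<lambda>k. coeffs D \<phi> g k / lam k) {..<m} = L2_set (\<lambda>k. \<bar>coeffs D \<phi> g k / lam k\<bar>) {..<m}"
    by (simp only: L2_set_def power2_abs)
  also have "\<dots> \<le> L2_set (\<lambda>k. (1 / \<gamma>) * \<bar>coeffs D \<phi> g k\<bar>) {..<m}"
    using \<gamma>_pos \<gamma>_le_lam lam_pos
    by (intro L2_set_mono) (auto simp: abs_divide abs_of_pos less_imp_le[OF lam_pos] intro!: divide_left_mono mult_pos_pos)
  also have "\<dots> = (1 / \<gamma>) * L2_set (\<lambda>k. \<bar>coeffs D \<phi> g k\<bar>) {..<m}"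
    using \<gamma>_pos by (intro L2_set_right_distrib[symmetric]) simp
  also have "L2_set (\<lambda>k. \<bar>coeffs D \<phi> g k\<bar>) {..<m} = L2_set (coeffs D \<phi> g) {..<m}"
    by (simp add: L2_set_def)
  finally show ?thesis
    using mult_left_mono[OF L2_set_coeffs_le[OF onb assms, of m], of "1 / \<gamma>"] \<gamma>_pos by simp
qed

text \<open>
  The factor in front of \<open>L2norm D g\<close> is exactly \<open>1/\<gamma>\<close>: for \<open>g = f(v)\<close> it is multiplied by the
  Lipschitz constant of \<open>f\<close>, and the product has to be less than \<open>1\<close>.
\<close>

lemma mild_solution_bound:
  assumes v: "v \<in> L2 D" and g: "g \<in> L2 D" and c: "c \<in> dotH lam (\<beta> - 2)" and beta: "0 \<le> \<beta>"
    and eq: "\<And>k. coeffs D \<phi> v k = coeffs D \<phi> g k / lam k + c k / lam k"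
  shows "L2norm D v \<le> L2norm D g / \<gamma> + lam 0 powr (- \<beta> / 2) * dotH_norm lam (\<beta> - 2) c"
proof (rule L2norm_le_of_partial_sums[OF onb v])
  fix n
  have "L2_set (coeffs D \<phi> v) {..<n}
      \<le> L2_set (\<lambda>k. coeffs D \<phi> g k / lam k) {..<n} + L2_set (\<lambda>k. c k / lam k) {..<n}"
    unfolding eq by (rule L2_set_triangle_ineq)
  then show "L2_set (coeffs D \<phi> v) {..<n}
      \<le> L2norm D g / \<gamma> + lam 0 powr (- \<beta> / 2) * dotH_norm lam (\<beta> - 2) c"
    using L2_set_divide_lam_le[OF g, of n] L2_set_A_inverse_le[OF c beta, of "{..<n}" 0] by simp
qed

text \<open>
  The comparison of \<open>v\<close> and \<open>U\<close> with \<open>w = A\<^sup>-\<^sup>1(P\<^sub>n g + P\<^sub>N c)\<close> and its Ritz projection. The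
  nonlinearity is evaluated at the exact solution, so that \<open>w\<close> is explicit and no
  semidiscrete problem has to be solved. The remainder \<open>\<delta>\<close> appears twice, in \<open>v - w\<close> and in the
  equation of \<open>R w - U\<close>.
\<close>

lemma pathwise_error_truncated:
  assumes dotH2: "dotH_is_sobolev D lam \<phi> 2"
    and V: "linear_subspace V" "V \<subseteq> sobolev0 D" and R: "ritz_projection D V R"
    and est: "\<And>n c. L2norm D (\<lambda>x. spectral_proj \<phi> n c x - R (spectral_proj \<phi> n c) x)
      \<le> K * L2_set (\<lambda>k. lam k * c k) {..<n}" and K: "0 \<le> K"
    and f: "\<And>x y. \<bar>f x - f y\<bar> \<le> L * \<bar>x - y\<bar>"
    and beta: "0 \<le> \<beta>" "\<beta> \<le> 2" and N: "1 \<le> N" "N \<le> n"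
    and c: "c \<in> dotH lam (\<beta> - 2)"
    and v: "v \<in> L2 D"
    and eq: "\<And>k. coeffs D \<phi> v k = coeffs D \<phi> (\<lambda>x. f (v x)) k / lam k + c k / lam k"
    and U: "U \<in> V"
    and U_eq: "\<And>z. z \<in> V \<Longrightarrow>
      grad_ip D U z = ip D (\<lambda>x. f (U x)) z + ip D (spectral_proj \<phi> N c) z"
  shows "(1 - L / \<gamma>) * L2norm D (\<lambda>x. v x - U x)
    \<le> lam N powr (- \<beta> / 2) * dotH_norm lam (\<beta> - 2) c
      + K * (L2norm D (\<lambda>x. f (v x)) + lam (N - 1) powr ((2 - \<beta>) / 2) * dotH_norm lam (\<beta> - 2) c)
      + 2 / \<gamma> * L2norm D (\<lambda>x. f (v x) - spectral_proj \<phi> n (coeffs D \<phi> (\<lambda>x. f (v x))) x)"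
proof -
  let ?X = "dotH_norm lam (\<beta> - 2) c"
  let ?g = "\<lambda>x. f (v x)" and ?fU = "\<lambda>x. f (U x)"
  let ?gn = "spectral_proj \<phi> n (coeffs D \<phi> ?g)"
  define \<delta> where "\<delta> = L2norm D (\<lambda>x. ?g x - ?gn x)"
  define cN where "cN k = (if k < N then c k else 0)" for k
  define a where "a k = (coeffs D \<phi> ?g k + cN k) / lam k" for k
  define w where "w = spectral_proj \<phi> n a"
  have U_L2: "U \<in> L2 D" using U V sobolev0_sobolev1 sobolev_L2 by blast
  have g: "?g \<in> L2 D" by (rule L2_Lipschitz_comp(1)[OF domain f v])
  have fU: "?fU \<in> L2 D" by (rule L2_Lipschitz_comp(1)[OF domain f U_L2])
  have gn: "?gn \<in> L2 D" by (rule spectral_proj_L2)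
  have gd: "(\<lambda>x. ?g x - ?gn x) \<in> L2 D" by (rule L2_diff[OF g gn])
  have w: "w \<in> sobolev0 D" "w \<in> L2 D"
    using spectral_proj_H2(1)[OF dotH2] spectral_proj_L2 by (auto simp: w_def)
  have Rw: "R w \<in> V" "R w \<in> sobolev0 D" and Rw_eq: "\<And>z. z \<in> V \<Longrightarrow> grad_ip D (R w) z = grad_ip D w z"
    using R w V by (auto simp: ritz_projection_def)
  have Rw_L2: "R w \<in> L2 D" using Rw sobolev0_sobolev1 sobolev_L2 by blast

  have lam_a: "lam k * a k = coeffs D \<phi> ?g k + cN k" for k using lam_pos[of k] by (simp add: a_def)
  have coeffs_gd: "coeffs D \<phi> (\<lambda>x. ?g x - ?gn x) k = (if k < n then 0 else coeffs D \<phi> ?g k)" for k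
    unfolding coeffs_diff[OF onb g gn] coeffs_spectral_proj by simp

  \<comment> \<open>The modes below \<open>N\<close> agree, those between \<open>N\<close> and \<open>n\<close> miss the noise, and those from \<open>n\<close> on
    miss the noise and the nonlinearity.\<close>
  have vw: "L2norm D (\<lambda>x. v x - w x) \<le> lam N powr (- \<beta> / 2) * ?X + \<delta> / \<gamma>"
  proof (rule L2norm_le_of_partial_sums[OF onb L2_diff[OF v w(2)]])
    fix m
    have "coeffs D \<phi> (\<lambda>x. v x - w x) k = (if k < N then 0 else c k / lam k)
        + coeffs D \<phi> (\<lambda>x. ?g x - ?gn x) k / lam k" for k
    proof -
      have "coeffs D \<phi> (\<lambda>x. v x - w x) k = coeffs D \<phi> v k - (if k < n then a k else 0)"
        unfolding coeffs_diff[OF onb v w(2)] by (simp only: w_def coeffs_spectral_proj)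
      then show ?thesis
        using N(2) unfolding coeffs_gd eq a_def cN_def by (auto simp: add_divide_distrib)
    qed
    then have "coeffs D \<phi> (\<lambda>x. v x - w x) = (\<lambda>k. (if k < N then 0 else c k / lam k)
        + coeffs D \<phi> (\<lambda>x. ?g x - ?gn x) k / lam k)" by blast
    then have "L2_set (coeffs D \<phi> (\<lambda>x. v x - w x)) {..<m}
        \<le> L2_set (\<lambda>k. if k < N then 0 else c k / lam k) {..<m}
          + L2_set (\<lambda>k. coeffs D \<phi> (\<lambda>x. ?g x - ?gn x) k / lam k) {..<m}"
      by (simp only: L2_set_triangle_ineq)
    also have "\<dots> \<le> lam N powr (- \<beta> / 2) * ?X + \<delta> / \<gamma>"
      unfolding \<delta>_def
      by (intro add_mono L2_set_A_inverse_le[OF c beta(1)] L2_set_divide_lam_le[OF gd]) simp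
    finally show "L2_set (coeffs D \<phi> (\<lambda>x. v x - w x)) {..<m} \<le> lam N powr (- \<beta> / 2) * ?X + \<delta> / \<gamma>" .
  qed

  have wRw: "L2norm D (\<lambda>x. w x - R w x)
      \<le> K * (L2norm D ?g + lam (N - 1) powr ((2 - \<beta>) / 2) * ?X)"
  proof -
    have "L2_set (\<lambda>k. lam k * a k) {..<n} \<le> L2_set (coeffs D \<phi> ?g) {..<n} + L2_set cN {..<n}"
      unfolding lam_a by (rule L2_set_triangle_ineq)
    also have "\<dots> \<le> L2norm D ?g + lam (N - 1) powr ((2 - \<beta>) / 2) * ?X"
      unfolding cN_def
      by (intro add_mono L2_set_coeffs_le[OF onb g] L2_set_noise_le[OF c beta(2) N(1)]) simp
    finally show ?thesis
      using est[of n a] mult_left_mono[OF _ K] unfolding w_def by (meson order_trans)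
  qed

  \<comment> \<open>Written as a linear combination, the form in which \<open>V\<close> is closed.\<close>
  define e where "e = (\<lambda>x. 1 * R w x + (-1) * U x)"
  have e: "e \<in> V" unfolding e_def using V(1) Rw(1) U unfolding linear_subspace_def by blast
  have e0: "e \<in> sobolev0 D" using e V by blast
  have e_L2: "e \<in> L2 D" using e0 sobolev0_sobolev1 sobolev_L2 by blast
  \<comment> \<open>Galerkin orthogonality replaces \<open>R w\<close> by \<open>w\<close>, so the projected noise drops out.\<close>
  have e_bound: "\<gamma> * L2norm D e \<le> \<delta> + L * L2norm D (\<lambda>x. v x - U x)"
  proof -
    have "grad_ip D (\<lambda>x. 1 * R w x + (-1) * U x) e = 1 * grad_ip D (R w) e + (-1) * grad_ip D U e"
      using Rw(2) U V e0
      by (intro grad_ip_lincomb_left[OF domain test_functions_total] sobolev0_sobolev1) auto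
    then have "grad_ip D e e = grad_ip D (R w) e - grad_ip D U e"
      unfolding e_def[symmetric] by simp
    also have "\<dots> = grad_ip D w e - (ip D ?fU e + ip D (spectral_proj \<phi> N c) e)"
      by (simp add: Rw_eq[OF e] U_eq[OF e])
    also have "grad_ip D w e = ip D ?gn e + ip D (spectral_proj \<phi> N c) e"
    proof -
      have "(\<Sum>k<n. cN k * ip D (\<phi> k) e) = (\<Sum>k<N. c k * ip D (\<phi> k) e)"
        using N(2) by (intro sum.mono_neutral_cong_right) (auto simp: cN_def)
      then show ?thesis
        unfolding w_def grad_ip_spectral_proj[OF e0] lam_a
        by (simp add: ip_spectral_proj[OF e_L2] algebra_simps sum.distrib)
    qed
    finally have eq: "grad_ip D e e = ip D (\<lambda>x. ?g x - ?fU x) e - ip D (\<lambda>x. ?g x - ?gn x) e"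
      by (simp add: ip_diff_left[OF g fU e_L2] ip_diff_left[OF g gn e_L2])
    have "L2norm D (\<lambda>x. ?g x - ?fU x) \<le> L * L2norm D (\<lambda>x. v x - U x)"
      using f order_trans[OF abs_ge_zero f[of 1 0]]
      by (intro L2norm_mono[OF L2_diff[OF g fU] L2_diff[OF v U_L2]]) auto
    then have "L2norm D (\<lambda>x. ?g x - ?fU x) * L2norm D e \<le> L * L2norm D (\<lambda>x. v x - U x) * L2norm D e"
      by (intro mult_right_mono) auto
    then have "grad_ip D e e \<le> (\<delta> + L * L2norm D (\<lambda>x. v x - U x)) * L2norm D e"
      using ip_Cauchy_Schwarz[OF L2_diff[OF g fU] e_L2] ip_Cauchy_Schwarz[OF gd e_L2]
      unfolding eq \<delta>_def distrib_right by linarith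
    moreover have "\<gamma> * (L2norm D e)\<^sup>2 \<le> grad_ip D e e"
      using poincare e0 by (simp add: poincare_constant_def)
    ultimately have "(\<gamma> * L2norm D e) * L2norm D e \<le> (\<delta> + L * L2norm D (\<lambda>x. v x - U x)) * L2norm D e"
      by (simp add: power2_eq_square mult_ac)
    moreover have "0 \<le> \<delta> + L * L2norm D (\<lambda>x. v x - U x)"
      using order_trans[OF abs_ge_zero f[of 1 0]] by (simp add: \<delta>_def)
    ultimately show ?thesis
      using L2norm_nonneg[of D e] by (cases "L2norm D e = 0") (auto simp: mult_le_cancel_right)
  qed

  have "L2norm D (\<lambda>x. v x - U x) \<le> L2norm D (\<lambda>x. v x - w x) + L2norm D (\<lambda>x. w x - U x)"
    using L2norm_triangle[OF L2_diff[OF v w(2)] L2_diff[OF w(2) U_L2]] by simp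
  also have "L2norm D (\<lambda>x. w x - U x) \<le> L2norm D (\<lambda>x. w x - R w x) + L2norm D e"
    using L2norm_triangle[OF L2_diff[OF w(2) Rw_L2] e_L2] by (simp add: e_def)
  also have "L2norm D e \<le> (\<delta> + L * L2norm D (\<lambda>x. v x - U x)) / \<gamma>"
    using e_bound \<gamma>_pos by (simp add: field_simps)
  finally have "L2norm D (\<lambda>x. v x - U x) \<le> lam N powr (- \<beta> / 2) * ?X
      + K * (L2norm D ?g + lam (N - 1) powr ((2 - \<beta>) / 2) * ?X)
      + 2 / \<gamma> * \<delta> + L / \<gamma> * L2norm D (\<lambda>x. v x - U x)"
    using vw wRw by (simp add: add_divide_distrib)
  then show ?thesis unfolding \<delta>_def by (simp add: left_diff_distrib)
qed

text \<open>
  Letting \<open>n\<close> tend to infinity removes the remainder, since the eigenfunctions are complete.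
\<close>

lemma pathwise_error:
  assumes dotH2: "dotH_is_sobolev D lam \<phi> 2"
    and V: "linear_subspace V" "V \<subseteq> sobolev0 D" and R: "ritz_projection D V R"
    and est: "\<And>n c. L2norm D (\<lambda>x. spectral_proj \<phi> n c x - R (spectral_proj \<phi> n c) x)
      \<le> K * L2_set (\<lambda>k. lam k * c k) {..<n}" and K: "0 \<le> K"
    and f: "\<And>x y. \<bar>f x - f y\<bar> \<le> L * \<bar>x - y\<bar>"
    and beta: "0 \<le> \<beta>" "\<beta> \<le> 2" and N: "1 \<le> N"
    and c: "c \<in> dotH lam (\<beta> - 2)"
    and v: "v \<in> L2 D"
    and eq: "\<And>k. coeffs D \<phi> v k = coeffs D \<phi> (\<lambda>x. f (v x)) k / lam k + c k / lam k"
    and U: "U \<in> V"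
    and U_eq: "\<And>z. z \<in> V \<Longrightarrow>
      grad_ip D U z = ip D (\<lambda>x. f (U x)) z + ip D (spectral_proj \<phi> N c) z"
  shows "(1 - L / \<gamma>) * L2norm D (\<lambda>x. v x - U x)
    \<le> lam N powr (- \<beta> / 2) * dotH_norm lam (\<beta> - 2) c
      + K * (L2norm D (\<lambda>x. f (v x)) + lam (N - 1) powr ((2 - \<beta>) / 2) * dotH_norm lam (\<beta> - 2) c)"
    (is "?lhs \<le> ?rhs")
proof (rule LIMSEQ_le_const)
  let ?g = "\<lambda>x. f (v x)"
  let ?\<delta> = "\<lambda>n. L2norm D (\<lambda>x. ?g x - spectral_proj \<phi> n (coeffs D \<phi> ?g) x)"
  have "?\<delta> \<longlonglongrightarrow> 0"
    using onb L2_Lipschitz_comp(1)[OF domain f v]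
    by (simp add: complete_onb_def spectral_proj_def coeffs_def)
  then have "(\<lambda>n. ?rhs + 2 / \<gamma> * ?\<delta> n) \<longlonglongrightarrow> ?rhs + 2 / \<gamma> * 0"
    by (intro tendsto_intros)
  then show "(\<lambda>n. ?rhs + 2 / \<gamma> * ?\<delta> n) \<longlonglongrightarrow> ?rhs" by simp
  show "\<exists>M. \<forall>n\<ge>M. ?lhs \<le> ?rhs + 2 / \<gamma> * ?\<delta> n"
    using pathwise_error_truncated[OF dotH2 V R est K f beta N _ c v eq U U_eq] by blast
qed

end

section \<open>The error in mean\<close>

text \<open>
  Some Lipschitz constant is needed for the supremum to be over a bounded set; the supremum is
  then itself a Lipschitz constant.
\<close>

lemma lipschitz_lip_seminorm:
  assumes "\<exists>L. L-lipschitz_on UNIV f"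
  shows "\<bar>f x - f y\<bar> \<le> lip_seminorm f * \<bar>x - y\<bar>"
proof (cases "x = y")
  case False
  obtain L where L: "L-lipschitz_on UNIV f" using assms by blast
  have "\<bar>f x - f y\<bar> / \<bar>x - y\<bar> \<le> lip_seminorm f"
    unfolding lip_seminorm_def
  proof (rule cSup_upper)
    show "bdd_above {\<bar>f x - f y\<bar> / \<bar>x - y\<bar> | x y. x \<noteq> y}"
      using lipschitz_onD[OF L] by (auto intro!: bdd_aboveI[of _ L] simp: dist_real_def divide_le_eq)
  qed (use False in blast)
  then show ?thesis using False by (simp add: divide_le_eq)
qed simp

text \<open>
  Only the pairings with fixed functions are known to be measurable. By Parseval's identity the
  norm is a countable expression in them.
\<close>

lemma L2norm_random_variable_measurable:
  assumes onb: "complete_onb D \<phi>" and u: "L2_random_variable M D u" and v: "L2_random_variable M D v"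
  shows "(\<lambda>\<omega>. L2norm D (\<lambda>x. u \<omega> x - v \<omega> x)) \<in> borel_measurable M"
proof -
  have [measurable]: "(\<lambda>\<omega>. coeffs D \<phi> (u \<omega>) k) \<in> borel_measurable M"
    "(\<lambda>\<omega>. coeffs D \<phi> (v \<omega>) k) \<in> borel_measurable M" for k
    using u v onb_L2[OF onb] by (auto simp: L2_random_variable_def coeffs_def)
  have "(\<lambda>\<omega>. sqrt (\<Sum>k. (coeffs D \<phi> (u \<omega>) k - coeffs D \<phi> (v \<omega>) k)\<^sup>2)) \<in> borel_measurable M"
    by measurable
  moreover have "L2norm D (\<lambda>x. u \<omega> x - v \<omega> x)
      = sqrt (\<Sum>k. (coeffs D \<phi> (u \<omega>) k - coeffs D \<phi> (v \<omega>) k)\<^sup>2)" if "\<omega> \<in> space M" for \<omega>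
  proof -
    have uv: "u \<omega> \<in> L2 D" "v \<omega> \<in> L2 D" using u v that by (auto simp: L2_random_variable_def)
    show ?thesis
      using Parseval[OF onb L2_diff[OF uv]] unfolding coeffs_diff[OF onb uv]
      by (simp add: sums_iff)
  qed
  ultimately show ?thesis by (simp cong: measurable_cong)
qed

lemma Lp_error_le_of_AE_bound:
  assumes meas: "(\<lambda>\<omega>. L2norm D (\<lambda>x. u \<omega> x - v \<omega> x)) \<in> borel_measurable M"
    and p: "p \<ge> 1" and int: "integrable M (\<lambda>\<omega>. Y \<omega> powr p)" and t: "0 \<le> t"
    and le: "AE \<omega> in M. L2norm D (\<lambda>x. u \<omega> x - v \<omega> x) \<le> t * Y \<omega>" and Y: "AE \<omega> in M. 0 \<le> Y \<omega>"
    and B: "t * (\<integral>\<omega>. Y \<omega> powr p \<partial>M) powr (1 / p) \<le> B"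
  shows "Lp_error_le M D p u v B"
proof -
  let ?E = "\<lambda>\<omega>. L2norm D (\<lambda>x. u \<omega> x - v \<omega> x) powr p"
  have bound: "AE \<omega> in M. ?E \<omega> \<le> t powr p * Y \<omega> powr p"
    using le Y
  proof eventually_elim
    case (elim \<omega>)
    have "?E \<omega> \<le> (t * Y \<omega>) powr p" using elim p by (intro powr_mono2) auto
    then show ?case using t elim by (simp add: powr_mult)
  qed
  have intE: "integrable M ?E"
  proof (rule Bochner_Integration.integrable_bound)
    show "integrable M (\<lambda>\<omega>. t powr p * Y \<omega> powr p)" using int by simp
    show "?E \<in> borel_measurable M" using meas by measurable
    show "AE \<omega> in M. norm (?E \<omega>) \<le> norm (t powr p * Y \<omega> powr p)"
      using bound by eventually_elim simp
  qed
  have "(\<integral>\<omega>. ?E \<omega> \<partial>M) \<le> (\<integral>\<omega>. t powr p * Y \<omega> powr p \<partial>M)"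
    using int by (intro integral_mono_AE intE bound) simp
  also have "\<dots> = t powr p * (\<integral>\<omega>. Y \<omega> powr p \<partial>M)" by simp
  finally have "(\<integral>\<omega>. ?E \<omega> \<partial>M) powr (1 / p) \<le> (t powr p * (\<integral>\<omega>. Y \<omega> powr p \<partial>M)) powr (1 / p)"
    using p by (intro powr_mono2) auto
  also have "\<dots> = t * (\<integral>\<omega>. Y \<omega> powr p \<partial>M) powr (1 / p)"
    using t p by (simp add: powr_mult powr_powr)
  finally show ?thesis unfolding Lp_error_le_def using intE B by linarith
qed

text \<open>
  An arbitrary power is dominated by an even one of larger exponent.
\<close>

lemma integrable_one_plus_powr:
  fixes p :: real
  assumes "finite_measure M" and X: "\<And>q. integrable M (\<lambda>\<omega>. X \<omega> ^ (2 * Suc q))"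
    and [measurable]: "X \<in> borel_measurable M" and nonneg: "AE \<omega> in M. 0 \<le> X \<omega>" and p: "0 \<le> p"
  shows "integrable M (\<lambda>\<omega>. (1 + X \<omega>) powr p)"
proof -
  interpret finite_measure M by fact
  obtain q :: nat where q: "p \<le> q" using real_arch_simple by blast
  show ?thesis
  proof (rule Bochner_Integration.integrable_bound)
    show "integrable M (\<lambda>\<omega>. 2 powr p * (1 + X \<omega> ^ (2 * Suc q)))"
      using X by (intro integrable_mult_right Bochner_Integration.integrable_add) auto
    show "AE \<omega> in M. norm ((1 + X \<omega>) powr p) \<le> norm (2 powr p * (1 + X \<omega> ^ (2 * Suc q)))"
      using nonneg
    proof eventually_elim
      case (elim \<omega>)
      let ?m = "max 1 (X \<omega>)"
      have "(1 + X \<omega>) powr p \<le> (2 * ?m) powr p" using elim p by (intro powr_mono2) auto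
      also have "\<dots> = 2 powr p * ?m powr p" by (simp add: powr_mult)
      also have "?m powr p \<le> ?m powr real (2 * Suc q)" using q by (intro powr_mono) auto
      also have "?m powr real (2 * Suc q) = ?m ^ (2 * Suc q)" by (rule powr_realpow) auto
      also have "\<dots> \<le> 1 + X \<omega> ^ (2 * Suc q)"
        using elim by (auto simp: max_def simp del: mult_Suc_right power_Suc)
      finally show ?case using elim by simp
    qed
  qed measurable
qed

text \<open>
  With \<open>x = h N\<^sup>1\<^sup>/\<^sup>d\<close> the sides are \<open>1 + x\<^sup>2\<close> and \<open>2 (1 + x\<^sup>k)\<close>, up to the common factor
  \<open>N\<^sup>-\<^sup>\<beta>\<^sup>/\<^sup>d\<close>. If \<open>x \<le> 1\<close>, then \<open>x\<^sup>2\<close> is dominated by the constant, otherwise by \<open>x\<^sup>k\<close>.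
\<close>

lemma rate_mono:
  assumes "0 \<le> h" "1 \<le> N" "(2::nat) \<le> k" "0 < d"
  shows "real N powr (- \<beta> / d) + h ^ 2 * real N powr ((2 - \<beta>) / d)
    \<le> 2 * (real N powr (- \<beta> / d) + h ^ k * real N powr ((real k - \<beta>) / d))"
proof -
  define x where "x = h * real N powr (1 / d)"
  have x: "0 \<le> x" using assms by (simp add: x_def)
  have pow: "h ^ j * real N powr ((real j - \<beta>) / d) = real N powr (- \<beta> / d) * x ^ j" for j
  proof -
    have "real N powr ((real j - \<beta>) / d) = real N powr (- \<beta> / d) * real N powr (real j * (1 / d))"
      by (simp add: powr_add[symmetric] diff_divide_distrib)
    also have "real N powr (real j * (1 / d)) = (real N powr (1 / d)) powr real j"
      by (simp only: powr_powr mult.commute)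
    also have "\<dots> = (real N powr (1 / d)) ^ j"
      using assms by (intro powr_realpow) simp
    finally show ?thesis by (simp add: x_def power_mult_distrib)
  qed
  have "1 + x ^ 2 \<le> 2 * (1 + x ^ k)"
  proof (cases "x \<le> 1")
    case True
    then have "x ^ 2 \<le> 1" using x by (intro power_le_one) auto
    then show ?thesis using zero_le_power[OF x, of k] unfolding distrib_left by linarith
  next
    case False
    then have "x ^ 2 \<le> x ^ k" using assms by (intro power_increasing) auto
    then show ?thesis using zero_le_power[OF x, of k] unfolding distrib_left by linarith
  qed
  then have "real N powr (- \<beta> / d) * (1 + x ^ 2) \<le> real N powr (- \<beta> / d) * (2 * (1 + x ^ k))"
    by (intro mult_left_mono) auto
  then show ?thesis using pow[of 2] pow[of k] by (simp add: algebra_simps)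
qed

text \<open>
  The sequence is indexed from \<open>0\<close>, so \<open>lam (N - 1)\<close> is the \<open>N\<close>-th eigenvalue, which Weyl's law
  compares with \<open>N\<^sup>2\<^sup>/\<^sup>d\<close>; for the lower bound, monotonicity passes to \<open>lam N\<close>.
\<close>

lemma weyl_powr_bounds:
  assumes "weyl_law d lam" and mono: "mono lam" and d: "0 < d" and beta: "0 \<le> \<beta>" "\<beta> \<le> 2"
  shows "\<exists>C>0. \<forall>N\<ge>1. lam N powr (- \<beta> / 2) \<le> C * real N powr (- \<beta> / d) \<and>
    lam (N - 1) powr ((2 - \<beta>) / 2) \<le> C * real N powr ((2 - \<beta>) / d)"
proof -
  obtain K where K: "K > 0" and w: "\<And>k. inverse K * real (k + 1) powr (2 / real d) \<le> lam k"
    "\<And>k. lam k \<le> K * real (k + 1) powr (2 / real d)"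
    using assms(1) unfolding weyl_law_def by blast
  let ?C = "K powr (\<beta> / 2) + K powr ((2 - \<beta>) / 2)"
  have lam: "0 < lam k" for k
  proof -
    have "0 < inverse K * real (k + 1) powr (2 / real d)" using K by simp
    then show ?thesis using w(1)[of k] by (rule less_le_trans)
  qed
  have 1: "lam N powr (- \<beta> / 2) \<le> K powr (\<beta> / 2) * real N powr (- \<beta> / d)" if "1 \<le> N" for N
  proof -
    have "inverse K * real N powr (2 / real d) \<le> lam (N - 1)" using w(1)[of "N - 1"] that by simp
    also have "\<dots> \<le> lam N" using mono by (simp add: mono_def)
    finally have "lam N powr (- \<beta> / 2) \<le> (inverse K * real N powr (2 / real d)) powr (- \<beta> / 2)"
      using K that beta by (intro powr_mono2') auto
    also have "\<dots> = inverse K powr (- \<beta> / 2) * real N powr (2 / real d * (- \<beta> / 2))"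
      using K by (simp add: powr_mult powr_powr)
    also have "inverse K powr (- \<beta> / 2) = K powr (\<beta> / 2)"
      using K by (simp add: inverse_powr powr_minus)
    also have "2 / real d * (- \<beta> / 2) = - \<beta> / d" by simp
    finally show ?thesis .
  qed
  have 2: "lam (N - 1) powr ((2 - \<beta>) / 2) \<le> K powr ((2 - \<beta>) / 2) * real N powr ((2 - \<beta>) / d)"
    if "1 \<le> N" for N
  proof -
    have "lam (N - 1) \<le> K * real N powr (2 / real d)" using w(2)[of "N - 1"] that by simp
    then have "lam (N - 1) powr ((2 - \<beta>) / 2) \<le> (K * real N powr (2 / real d)) powr ((2 - \<beta>) / 2)"
      using lam[of "N - 1"] beta by (intro powr_mono2) auto
    also have "\<dots> = K powr ((2 - \<beta>) / 2) * real N powr (2 / real d * ((2 - \<beta>) / 2))"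
      using K by (simp add: powr_mult powr_powr)
    also have "2 / real d * ((2 - \<beta>) / 2) = (2 - \<beta>) / d" using d by (simp add: field_simps)
    finally show ?thesis .
  qed
  show ?thesis
  proof (intro exI[of _ ?C] conjI allI impI)
    show "?C > 0" using K by (simp add: add_pos_pos)
    fix N :: nat assume N: "1 \<le> N"
    show "lam N powr (- \<beta> / 2) \<le> ?C * real N powr (- \<beta> / d)"
      using 1[OF N] by (simp add: distrib_right add_increasing2)
    show "lam (N - 1) powr ((2 - \<beta>) / 2) \<le> ?C * real N powr ((2 - \<beta>) / d)"
      using 2[OF N] by (simp add: distrib_right add_increasing)
  qed
qed

context dirichlet_problem
begin

lemma ritz_error_spectral_proj:
  assumes dotH2: "dotH_is_sobolev D lam \<phi> 2" and ritz_est: "ritz_estimate D H R 2"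
  shows "\<exists>K>0. \<forall>h\<in>H. \<forall>n c. L2norm D (\<lambda>x. spectral_proj \<phi> n c x - R h (spectral_proj \<phi> n c) x)
    \<le> K * h ^ 2 * L2_set (\<lambda>k. lam k * c k) {..<n}"
proof -
  obtain C where C: "C > 0"
    "\<And>n c. sobolev_norm D 2 (spectral_proj \<phi> n c) \<le> C * L2_set (\<lambda>k. lam k * c k) {..<n}"
    using spectral_proj_H2(2)[OF dotH2] by blast
  obtain K where K: "K > 0" "\<And>h w. h \<in> H \<Longrightarrow> w \<in> sobolev0 D \<inter> sobolev D 2 \<Longrightarrow>
      L2norm D (\<lambda>x. w x - R h w x) \<le> K * h ^ 2 * sobolev_norm D 2 w"
    using ritz_est unfolding ritz_estimate_def by blast
  have "L2norm D (\<lambda>x. spectral_proj \<phi> n c x - R h (spectral_proj \<phi> n c) x)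
      \<le> (K * C) * h ^ 2 * L2_set (\<lambda>k. lam k * c k) {..<n}" if "h \<in> H" for h n c
  proof -
    have "K * h ^ 2 * sobolev_norm D 2 (spectral_proj \<phi> n c)
        \<le> K * h ^ 2 * (C * L2_set (\<lambda>k. lam k * c k) {..<n})"
      using K(1) by (intro mult_left_mono C(2)) simp
    with K(2)[OF that spectral_proj_H2(1)[OF dotH2], of n c] show ?thesis by (simp add: mult.assoc mult.left_commute)
  qed
  then show ?thesis using K(1) C(1) by (intro exI[of _ "K * C"]) simp
qed

text \<open>
  What remains is to bound \<open>f(v)\<close> by the noise. With \<open>\<kappa> = 1 - L/\<gamma> > 0\<close>, the a priori estimate and
  the linear growth of \<open>f\<close> give \<open>\<kappa> \<parallel>v\<parallel> \<le> F/\<gamma> + l X\<close>, which leads to the constant \<open>G\<close>. As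
  \<open>\<beta> \<le> 2\<close>, the contribution of \<open>f(v)\<close> to the Ritz error is at most of the order of that of the
  noise.
\<close>

lemma pathwise_rate:
  fixes f :: "real \<Rightarrow> real"
  assumes dotH2: "dotH_is_sobolev D lam \<phi> 2" and ritz_est: "ritz_estimate D H R 2"
    and V: "\<And>h. h \<in> H \<Longrightarrow> linear_subspace (V h) \<and> V h \<subseteq> sobolev0 D"
    and R: "\<And>h. h \<in> H \<Longrightarrow> ritz_projection D (V h) (R h)"
    and weyl: "weyl_law d lam" and d: "0 < d"
    and f: "\<And>x y. \<bar>f x - f y\<bar> \<le> L * \<bar>x - y\<bar>" and L: "L < \<gamma>"
    and beta: "0 \<le> \<beta>" "\<beta> \<le> 2"
  shows "\<exists>C>0. \<forall>N\<ge>1. \<forall>h\<in>H. \<forall>c\<in>dotH lam (\<beta> - 2). \<forall>v\<in>L2 D. \<forall>U\<in>V h.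
    (\<forall>k. coeffs D \<phi> v k = coeffs D \<phi> (\<lambda>x. f (v x)) k / lam k + c k / lam k) \<longrightarrow>
    (\<forall>z\<in>V h. grad_ip D U z = ip D (\<lambda>x. f (U x)) z + ip D (spectral_proj \<phi> N c) z) \<longrightarrow>
    L2norm D (\<lambda>x. v x - U x) \<le> C * (real N powr (- \<beta> / d) + h ^ 2 * real N powr ((2 - \<beta>) / d))
      * (1 + dotH_norm lam (\<beta> - 2) c)"
proof -
  obtain K where K: "K > 0"
    "\<And>h n c. h \<in> H \<Longrightarrow> L2norm D (\<lambda>x. spectral_proj \<phi> n c x - R h (spectral_proj \<phi> n c) x)
      \<le> K * h ^ 2 * L2_set (\<lambda>k. lam k * c k) {..<n}"
    using ritz_error_spectral_proj[OF dotH2 ritz_est] by blast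
  have "mono lam" using lam_mono by (simp add: mono_def)
  from weyl_powr_bounds[OF weyl this d beta] obtain Cw where Cw: "Cw > 0"
    "\<And>N. 1 \<le> N \<Longrightarrow> lam N powr (- \<beta> / 2) \<le> Cw * real N powr (- \<beta> / d)"
    "\<And>N. 1 \<le> N \<Longrightarrow> lam (N - 1) powr ((2 - \<beta>) / 2) \<le> Cw * real N powr ((2 - \<beta>) / d)"
    by blast
  have L0: "0 \<le> L" using order_trans[OF abs_ge_zero f[of 1 0]] by simp
  define \<kappa> where "\<kappa> = 1 - L / \<gamma>"
  have \<kappa>: "0 < \<kappa>" using L \<gamma>_pos by (simp add: \<kappa>_def)
  define F where "F = L2norm D (\<lambda>x. f 0)"
  define l where "l = lam 0 powr (- \<beta> / 2)"
  define G where "G = F + L * (F / \<gamma> + l) / \<kappa>"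
  have F: "0 \<le> F" and l: "0 \<le> l" by (simp_all add: F_def l_def)
  have G: "0 \<le> G" using F l L0 \<kappa> \<gamma>_pos by (simp add: G_def)
  define C where "C = (Cw + K * (G + Cw)) / \<kappa>"
  have "C > 0" using Cw K G \<kappa> by (simp add: C_def add_pos_nonneg)
  moreover have "L2norm D (\<lambda>x. v x - U x)
      \<le> C * (real N powr (- \<beta> / d) + h ^ 2 * real N powr ((2 - \<beta>) / d)) * (1 + dotH_norm lam (\<beta> - 2) c)"
    if N: "1 \<le> N" and h: "h \<in> H" and c: "c \<in> dotH lam (\<beta> - 2)" and v: "v \<in> L2 D" and U: "U \<in> V h"
      and eq: "\<And>k. coeffs D \<phi> v k = coeffs D \<phi> (\<lambda>x. f (v x)) k / lam k + c k / lam k"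
      and U_eq: "\<And>z. z \<in> V h \<Longrightarrow>
        grad_ip D U z = ip D (\<lambda>x. f (U x)) z + ip D (spectral_proj \<phi> N c) z" for N h c v U
  proof -
    let ?X = "dotH_norm lam (\<beta> - 2) c"
    let ?g = "L2norm D (\<lambda>x. f (v x))"
    let ?P = "real N powr (- \<beta> / d)" and ?S = "real N powr ((2 - \<beta>) / d)"
    have X: "0 \<le> ?X" by (rule dotH_norm_nonneg[OF lam_pos c])
    have growth: "?g \<le> L * L2norm D v + F"
      unfolding F_def by (rule L2_Lipschitz_comp(2)[OF domain f v])
    have "?g \<le> G * (1 + ?X)"
    proof -
      have "L2norm D v \<le> ?g / \<gamma> + l * ?X"
        unfolding l_def
        by (rule mild_solution_bound[OF v L2_Lipschitz_comp(1)[OF domain f v] c beta(1) eq])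
      also have "\<dots> \<le> (L * L2norm D v + F) / \<gamma> + l * ?X"
        using growth \<gamma>_pos by (simp add: divide_right_mono)
      finally have "\<kappa> * L2norm D v \<le> F / \<gamma> + l * ?X"
        by (simp add: \<kappa>_def algebra_simps add_divide_distrib)
      also have "\<dots> \<le> (F / \<gamma> + l) * (1 + ?X)"
        using F l X \<gamma>_pos by (simp add: algebra_simps)
      finally have "L2norm D v \<le> (F / \<gamma> + l) / \<kappa> * (1 + ?X)"
        using \<kappa> by (simp add: field_simps)
      then have "L * L2norm D v \<le> L * ((F / \<gamma> + l) / \<kappa> * (1 + ?X))"
        using L0 by (rule mult_left_mono)
      moreover have "F \<le> F * (1 + ?X)" using F X by (simp add: algebra_simps)
      moreover have "G * (1 + ?X) = F * (1 + ?X) + L * ((F / \<gamma> + l) / \<kappa> * (1 + ?X))"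
        unfolding G_def by (subst distrib_right) (simp add: mult.assoc)
      ultimately show ?thesis using growth by linarith
    qed
    moreover have "1 \<le> ?S" using N beta by (intro ge_one_powr_ge_zero) auto
    ultimately have g: "?g \<le> G * ?S * (1 + ?X)"
      using G X mult_right_mono[of 1 ?S "G * (1 + ?X)"] by (simp add: mult_ac)
    have X1: "t * ?X \<le> Cw * y * (1 + ?X)" if "t \<le> Cw * y" "0 \<le> y" for t y
    proof -
      have "t * ?X \<le> Cw * y * ?X" using that X by (intro mult_right_mono)
      also have "\<dots> \<le> Cw * y * (1 + ?X)" using Cw(1) that by (intro mult_left_mono) auto
      finally show ?thesis .
    qed
    have "\<kappa> * L2norm D (\<lambda>x. v x - U x) \<le> lam N powr (- \<beta> / 2) * ?X
        + (K * h ^ 2) * (?g + lam (N - 1) powr ((2 - \<beta>) / 2) * ?X)"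
      unfolding \<kappa>_def
      using V[OF h] K(1) by (intro pathwise_error[OF dotH2 _ _ R[OF h] K(2)[OF h] _ f beta N c v eq U U_eq]) auto
    also have "\<dots> \<le> Cw * ?P * (1 + ?X) + (K * h ^ 2) * (G * ?S * (1 + ?X) + Cw * ?S * (1 + ?X))"
      using K(1) by (intro add_mono mult_left_mono X1 g Cw N) auto
    also have "\<dots> = (Cw * ?P + K * (G + Cw) * (h ^ 2 * ?S)) * (1 + ?X)"
      by (simp add: algebra_simps)
    also have "\<dots> \<le> ((Cw + K * (G + Cw)) * (?P + h ^ 2 * ?S)) * (1 + ?X)"
    proof (rule mult_right_mono)
      have "0 \<le> Cw * (h ^ 2 * ?S)" "0 \<le> K * (G + Cw) * ?P" using Cw K G by simp_all
      then show "Cw * ?P + K * (G + Cw) * (h ^ 2 * ?S) \<le> (Cw + K * (G + Cw)) * (?P + h ^ 2 * ?S)"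
        by (simp add: algebra_simps)
    qed (use X in simp)
    finally show ?thesis using \<kappa> by (simp add: C_def field_simps)
  qed
  ultimately show ?thesis by blast
qed

end

theorem theorem3p2:
  fixes M :: "'w measure"
    and D :: "'a::euclidean_space set"
    and lam :: "nat \<Rightarrow> real" and \<phi> :: "nat \<Rightarrow> 'a \<Rightarrow> real"
    and dm :: "('a \<Rightarrow> real) set" and Q :: "('a \<Rightarrow> real) \<Rightarrow> 'a \<Rightarrow> real"
    and \<sigma> :: "nat \<Rightarrow> real" and \<psi> :: "nat \<Rightarrow> 'a \<Rightarrow> real"
    and \<eta> :: "nat \<Rightarrow> 'w \<Rightarrow> real" and W :: "'w \<Rightarrow> nat \<Rightarrow> real"
    and H :: "real set" and \<T> :: "real \<Rightarrow> 'a set set"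
    and r :: nat and V :: "real \<Rightarrow> ('a \<Rightarrow> real) set"
    and R :: "real \<Rightarrow> ('a \<Rightarrow> real) \<Rightarrow> 'a \<Rightarrow> real"
    and f :: "real \<Rightarrow> real" and p \<beta> \<gamma> :: real
    and u :: "'w \<Rightarrow> 'a \<Rightarrow> real" and uh :: "nat \<Rightarrow> real \<Rightarrow> 'w \<Rightarrow> 'a \<Rightarrow> real"
  assumes prob: "prob_space M"
    and domain: "regular_domain D"
    and eigensystem: "dirichlet_eigensystem D lam \<phi>"
    and weyl: "weyl_law DIM('a) lam"
    and dotH: "\<forall>s \<le> r + 1. dotH_is_sobolev D lam \<phi> s"
    and covariance: "covariance_eigensystem D dm Q \<sigma> \<psi>"
    and normals: "iid_std_normal M \<eta>"
    and meshes: "quasiuniform_family D H \<T>"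
    and degree: "r \<ge> 1"
    and spaces: "\<forall>h\<in>H. fe_space D (\<T> h) r (V h)"
    and approx: "approximation_property D H r V"
    and ritz: "\<forall>h\<in>H. ritz_projection D (V h) (R h)"
    and ritz_est: "ritz_estimate D H R 2" "ritz_estimate D H R (r + 1)"
    and p: "p \<ge> 1"
    and poincare: "poincare_constant D \<gamma>"
    and lipschitz: "\<exists>L. L-lipschitz_on UNIV f"
    and lip_less: "lip_seminorm f < \<gamma>"
    and beta: "0 \<le> \<beta>" "\<beta> \<le> 2"
    and HS: "HS_finite D lam \<phi> \<sigma> \<psi> ((\<beta> - 2) / 2)"
    and W: "noise M D lam \<phi> \<sigma> \<psi> \<eta> (\<beta> - 2) W"
    and u: "mild_solution M D lam \<phi> f W u"
    and uh: "\<forall>N\<ge>1. \<forall>h\<in>H. fe_solution M D \<phi> f W N (V h) (uh N h)"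
  shows "(\<exists>C>0. \<forall>N\<ge>1. \<forall>h\<in>H. Lp_error_le M D p u (uh N h)
            (C * (real N powr (- \<beta> / DIM('a)) + h ^ 2 * real N powr ((2 - \<beta>) / DIM('a)))
               * (1 + HS_norm D lam \<phi> \<sigma> \<psi> ((\<beta> - 2) / 2)))) \<and>
         (r \<ge> 2 \<and> bounded_derivs_upto (r - 1) f \<longrightarrow>
          (\<exists>C>0. \<forall>N\<ge>1. \<forall>h\<in>H. Lp_error_le M D p u (uh N h)
            (C * (real N powr (- \<beta> / DIM('a)) + h ^ (r + 1) * real N powr ((real r + 1 - \<beta>) / DIM('a)))
               * (1 + HS_norm D lam \<phi> \<sigma> \<psi> ((\<beta> - 2) / 2)))))"
proof -
  interpret prob_space M by (rule prob)
  have D: "D \<in> lmeasurable"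
    using domain by (simp add: regular_domain_def lmeasurable_open)
  have "dotH_is_sobolev D lam \<phi> 0" using dotH by blast
  then interpret dirichlet_problem D lam \<phi> \<gamma>
    using D eigensystem poincare by unfold_locales
  have dotH2: "dotH_is_sobolev D lam \<phi> 2" using dotH degree by simp
  let ?X = "\<lambda>\<omega>. dotH_norm lam (\<beta> - 2) (W \<omega>)"
  let ?HS = "HS_norm D lam \<phi> \<sigma> \<psi> ((\<beta> - 2) / 2)"
  let ?rate = "\<lambda>N h. real N powr (- \<beta> / DIM('a)) + h ^ 2 * real N powr ((2 - \<beta>) / DIM('a))"
  obtain C where C: "C > 0" and error: "\<And>N h c v U. 1 \<le> N \<Longrightarrow> h \<in> H \<Longrightarrow> c \<in> dotH lam (\<beta> - 2) \<Longrightarrow>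
      v \<in> L2 D \<Longrightarrow> U \<in> V h \<Longrightarrow>
      \<forall>k. coeffs D \<phi> v k = coeffs D \<phi> (\<lambda>x. f (v x)) k / lam k + c k / lam k \<Longrightarrow>
      \<forall>z\<in>V h. grad_ip D U z = ip D (\<lambda>x. f (U x)) z + ip D (spectral_proj \<phi> N c) z \<Longrightarrow>
      L2norm D (\<lambda>x. v x - U x) \<le> C * ?rate N h * (1 + dotH_norm lam (\<beta> - 2) c)"
    using pathwise_rate[OF dotH2 ritz_est(1) _ _ weyl DIM_positive
        lipschitz_lip_seminorm[OF lipschitz] lip_less beta, of V] spaces ritz
    unfolding fe_space_def by blast
  have Wmem: "AE \<omega> in M. W \<omega> \<in> dotH lam (\<beta> - 2)" using W by (simp add: noise_def)
  have X0: "AE \<omega> in M. 0 \<le> ?X \<omega>"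
    using Wmem by eventually_elim (rule dotH_norm_nonneg[OF lam_pos])
  have intX: "integrable M (\<lambda>\<omega>. (1 + ?X \<omega>) powr p)"
    using p X0 by (intro integrable_one_plus_powr finite_measure_axioms
        noise_moments_finite[OF prob lam_pos normals HS W] noise_norm_measurable[OF W]) auto
  \<comment> \<open>The constant may depend on the law of the noise, of which only this moment enters. The factor
    \<open>1 + ?HS\<close> is at least \<open>1\<close>.\<close>
  define m where "m = (\<integral>\<omega>. (1 + ?X \<omega>) powr p \<partial>M) powr (1 / p)"
  have m: "0 \<le> m" by (simp add: m_def)
  have HS0: "0 \<le> ?HS"
    unfolding HS_norm_def using HS
    by (auto simp: HS_finite_def intro!: suminf_nonneg)
  have err: "Lp_error_le M D p u (uh N h) B"
    if N: "1 \<le> N" and h: "h \<in> H" and B: "C * ?rate N h * m \<le> B" for N h B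
  proof (rule Lp_error_le_of_AE_bound)
    have U: "fe_solution M D \<phi> f W N (V h) (uh N h)" using uh N h by blast
    show "(\<lambda>\<omega>. L2norm D (\<lambda>x. u \<omega> x - uh N h \<omega> x)) \<in> borel_measurable M"
      using u U by (intro L2norm_random_variable_measurable[OF onb])
        (auto simp: mild_solution_def fe_solution_def)
    have u_eq: "AE \<omega> in M. \<forall>k. coeffs D \<phi> (u \<omega>) k
        = A_pow lam (-1) (coeffs D \<phi> (\<lambda>x. f (u \<omega> x))) k + A_pow lam (-1) (W \<omega>) k"
      using u by (simp add: mild_solution_def)
    have U_eq: "AE \<omega> in M. \<forall>z\<in>V h. grad_ip D (uh N h \<omega>) z
        = ip D (\<lambda>x. f (uh N h \<omega> x)) z + ip D (spectral_proj \<phi> N (W \<omega>)) z"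
      using U by (simp add: fe_solution_def)
    show "AE \<omega> in M. L2norm D (\<lambda>x. u \<omega> x - uh N h \<omega> x) \<le> C * ?rate N h * (1 + ?X \<omega>)"
      using Wmem u_eq U_eq AE_space
    proof eventually_elim
      case (elim \<omega>)
      show ?case
      proof (rule error[OF N h elim(1)])
        show "u \<omega> \<in> L2 D" using u elim(4) by (simp add: mild_solution_def L2_random_variable_def)
        show "uh N h \<omega> \<in> V h" using U elim(4) by (simp add: fe_solution_def)
        show "\<forall>k. coeffs D \<phi> (u \<omega>) k = coeffs D \<phi> (\<lambda>x. f (u \<omega> x)) k / lam k + W \<omega> k / lam k"
          using elim(2) less_imp_le[OF lam_pos]
          by (simp add: A_pow_def powr_minus powr_one divide_inverse mult.commute)
        show "\<forall>z\<in>V h. grad_ip D (uh N h \<omega>) z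
            = ip D (\<lambda>x. f (uh N h \<omega> x)) z + ip D (spectral_proj \<phi> N (W \<omega>)) z"
          by (rule elim(3))
      qed
    qed
    show "AE \<omega> in M. 0 \<le> 1 + ?X \<omega>" using X0 by eventually_elim simp
    show "C * ?rate N h * (\<integral>\<omega>. (1 + ?X \<omega>) powr p \<partial>M) powr (1 / p) \<le> B"
      using B by (simp add: m_def)
  qed (use p intX C in auto)
  have bound: "C * ?rate N h * m \<le> C * (m + 1) * ?rate N h * (1 + ?HS)" for N h
  proof -
    have "C * ?rate N h * m \<le> C * ?rate N h * ((m + 1) * (1 + ?HS))"
      using C m HS0 by (intro mult_left_mono) (auto simp: algebra_simps)
    then show ?thesis by (simp add: mult_ac)
  qed
  have part1: "\<exists>C>0. \<forall>N\<ge>1. \<forall>h\<in>H. Lp_error_le M D p u (uh N h) (C * ?rate N h * (1 + ?HS))"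
    using C m bound err by (intro exI[of _ "C * (m + 1)"]) (auto intro!: mult_pos_pos add_nonneg_pos)
  have part2: "\<exists>C>0. \<forall>N\<ge>1. \<forall>h\<in>H. Lp_error_le M D p u (uh N h)
      (C * (real N powr (- \<beta> / DIM('a)) + h ^ (r + 1) * real N powr ((real r + 1 - \<beta>) / DIM('a)))
        * (1 + ?HS))"
  proof (intro exI[of _ "C * (m + 1) * 2"] conjI allI impI ballI)
    show "0 < C * (m + 1) * 2" using C m by (simp add: add_nonneg_pos)
    fix N :: nat and h assume N: "1 \<le> N" and h: "h \<in> H"
    let ?rate' = "real N powr (- \<beta> / DIM('a)) + h ^ (r + 1) * real N powr ((real r + 1 - \<beta>) / DIM('a))"
    have h0: "0 \<le> h" using meshes h by (auto simp: quasiuniform_family_def)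
    have "?rate N h \<le> 2 * ?rate'"
      using rate_mono[OF h0 N, of "r + 1" "DIM('a)" \<beta>] degree by (simp add: add.commute)
    then have "C * (m + 1) * (1 + ?HS) * ?rate N h \<le> C * (m + 1) * (1 + ?HS) * (2 * ?rate')"
      using C m HS0 by (intro mult_left_mono) auto
    also have "\<dots> = C * (m + 1) * 2 * ?rate' * (1 + ?HS)" by (simp only: mult_ac)
    finally have "C * (m + 1) * ?rate N h * (1 + ?HS) \<le> C * (m + 1) * 2 * ?rate' * (1 + ?HS)"
      by (simp only: mult_ac)
    with bound[of N h] show "Lp_error_le M D p u (uh N h) (C * (m + 1) * 2 * ?rate' * (1 + ?HS))"
      by (intro err[OF N h]) (rule order_trans)
  qed
  from part1 part2 show ?thesis by blast
qed

end
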